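(* Let $r\ge1$ and $a,b\in\{0,1\}$. Then $$H_r(a,b)=\sum_{\rho\in K_{2r+1}}x^{s(\rho)}\sum_{\substack{r_1+\dots+r_{f(\rho)}=r-c(\rho)\\ r_j\ge0}}L^\rho_{r_1,\ldots,r_{f(\rho)}}(a,b).$$
   Context: Permutations are words. An occurrence of $132$ in $\pi=\pi_1\cdots\pi_n$ is a triple $i<j<k$ with $\pi_i<\pi_k<\pi_j$, and $132(\pi)$ is the number of occurrences. $\operatorname{sign}(\pi)=(-1)^{\#\text{inversions}}$, and $\pi$ is even or odd according as its sign is $1$ or $-1$; the empty permutation is even. Let $e^r(n)$ and $o^r(n)$ be the numbers of even and of odd $\pi\in\mathfrak S_n$ with $132(\pi)=r$. Put $E_r(x)=\sum_{n\ge0}e^r(n)x^n$ and $O_r(x)=\sum_{n\ge0}o^r(n)x^n$. For $a,b\in\{0,1\}$ let $H_r(a,0)=\tfrac12(E_r(x)+(-1)^aE_r(-x))$ and $H_r(a,1)=\tfrac12(O_r(x)+(-1)^aO_r(-x))$. Kernel: form the bipartite graph whose vertices are the entries of $\pi$ and the occurrences of $132$ in $\pi$, an entry being joined to each occurrence containing it. The kernel of $\pi\in\mathfrak S_n$ is the subsequence of entries lying in the connected component containing the entry $n$. Its order-isomorphic permutation $\rho\in\mathfrak S_s$ is the kernel shape, with size $s(\rho)=s$ and capacity $c(\rho)=132(\rho)$. A kernel permutation is one that is the kernel shape of some permutation. $K_t$ is the set of kernel shapes of permutations in $\mathfrak S_t$. Cells: for a kernel permutation $\rho\in\mathfrak S_s$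 and $1\le m\le s$, $1\le l\le s+1$, the cell $C_{ml}$ is the region of positions strictly between the $(l-1)$-st and $l$-th kernel entries (before the first if $l=1$, after the last if $l=s+1$) and values strictly between the $(m-1)$-st and $m$-th smallest kernel entries (below the smallest if $m=1$). $C_{ml}$ is infeasible if an element inserted into $\rho$ at a position between $\rho(l-1)$ and $\rho(l)$, with value between $m-1$ and $m$, would form a $132$ with two entries of $\rho$; otherwise it is feasible. Every non-kernel entry of a permutation with kernel shape $\rho$ lies in a feasible cell. Ordering distinct feasible cells by $C_{ml}\prec C_{m'l'}$ iff $m\ge m'$ and $l\le l'$ gives a linear order $C^1\prec\dots\prec C^{f(\rho)}$. The $k$-th kernel entry lies below $C_{ml}$ if $\rho(k)<m$ and above otherwise; it lies left of $C_{ml}$ if $k<l$ and right otherwise. $l_j(\rho)$ is the number of $k$ such that the $k$-th kernel entry is above-left or below-right of $C^j$. For $\mathbf v\in\{0,1\}^{f(\rho)}$ write $|\mathbf v|=\sum v_i$. Let $X^\rho_\epsilon=\{\mathbf v: (-1)^{|\mathbf v|+s(\rho)}=\epsilon\}$ and $Y^\rho_\epsilon=\{\mathbf v:(-1)^{|\mathbf v|}=\epsilon\}$ for $\epsilon=\pm1$. Let $z_\rho(\mathbf v)=(-1)^{\sum_{i<j}v_iv_j+\sum_j l_j(\rho)v_j}\operatorname{sign}(\rho)$. Finally $$L^\rho_{r_1,\dots,r_{f(\rho)}}(a,b)=\sum_{\mathbf v\in X^\rho_{(-1)^a}}\ \sum_{\mathbf u\in Y^\rho_{(-1)^bz_\rho(\mathbf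 v)}}\ \prod_{j=1}^{f(\rho)}H_{r_j}(v_j,u_j).$$ *)

theory Defs
  imports
    "HOL-Combinatorics.Multiset_Permutations"
    "HOL-Computational_Algebra.Formal_Power_Series"
begin

text \<open>
  A permutation of size \<open>n\<close> is a word over \<open>{1..n}\<close>, i.e. an element of
  \<^term>\<open>permutations_of_set {1..n}\<close>.  Values are 1-based, list positions are 0-based.
\<close>

definition occs132 :: "nat list \<Rightarrow> (nat \<times> nat \<times> nat) set" where
  "occs132 w = {(i, j, k). i < j \<and> j < k \<and> k < length w \<and> w ! i < w ! k \<and> w ! k < w ! j}"

definition num132 :: "nat list \<Rightarrow> nat" where
  "num132 w = card (occs132 w)"

definition inversions :: "nat list \<Rightarrow> (nat \<times> nat) set" where
  "inversions w = {(i, j). i < j \<and> j < length w \<and> w ! j < w ! i}"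

definition word_sign :: "nat list \<Rightarrow> int" where
  "word_sign w = (-1) ^ card (inversions w)"

definition even_count :: "nat \<Rightarrow> nat \<Rightarrow> nat" where
  "even_count r n = card {p \<in> permutations_of_set {1..n}. word_sign p = 1 \<and> num132 p = r}"

definition odd_count :: "nat \<Rightarrow> nat \<Rightarrow> nat" where
  "odd_count r n = card {p \<in> permutations_of_set {1..n}. word_sign p = -1 \<and> num132 p = r}"

definition E_gf :: "nat \<Rightarrow> rat fps" where
  "E_gf r = Abs_fps (\<lambda>n. of_nat (even_count r n))"

definition O_gf :: "nat \<Rightarrow> rat fps" where
  "O_gf r = Abs_fps (\<lambda>n. of_nat (odd_count r n))"

text \<open>Only the arguments \<open>a, b \<in> {0, 1}\<close> are meaningful.\<close>

definition H_gf :: "nat \<Rightarrow> nat \<Rightarrow> nat \<Rightarrow> rat fps" where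
  "H_gf r a b =
     (let G = (if b = 0 then E_gf r else O_gf r)
      in fps_const (1/2) * (G + (-1) ^ a * (G oo (- fps_X))))"


text \<open>
  Edges of the bipartite graph: an entry, given by its position, is \<open>Inl p\<close>, and an occurrence
  of 132 is \<open>Inr t\<close>.
\<close>

definition kernel_edges :: "nat list \<Rightarrow> ((nat + nat \<times> nat \<times> nat) \<times> (nat + nat \<times> nat \<times> nat)) set" where
  "kernel_edges w = {(Inl p, Inr (i, j, k)) | p i j k. (i, j, k) \<in> occs132 w \<and> p \<in> {i, j, k}}"

definition kernel_positions :: "nat list \<Rightarrow> nat set" where
  "kernel_positions w =
     {q. q < length w \<and>
         (\<exists>p < length w. w ! p = length w \<and>
            (Inl p, Inl q) \<in> (kernel_edges w \<union> (kernel_edges w)\<inverse>)\<^sup>*)}"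

definition kernel :: "nat list \<Rightarrow> nat list" where
  "kernel w = nths w (kernel_positions w)"

definition standardize :: "nat list \<Rightarrow> nat list" where
  "standardize w = map (\<lambda>x. card {y \<in> set w. y \<le> x}) w"

definition kernel_shape :: "nat list \<Rightarrow> nat list" where
  "kernel_shape w = standardize (kernel w)"

definition kernel_shapes :: "nat \<Rightarrow> nat list set" where
  "kernel_shapes t = kernel_shape ` permutations_of_set {1..t}"


text \<open>
  The cell \<open>C\<^sub>m\<^sub>l\<close> is represented by the pair \<open>(m, l)\<close>.  Inserting an element into it gives the
  new element the value \<open>m\<close> (values \<open>\<ge> m\<close> are shifted up) and the 0-based position \<open>l - 1\<close>.
\<close>

definition insert_cell :: "nat list \<Rightarrow> nat \<times> nat \<Rightarrow> nat list" where
  "insert_cell \<rho> = (\<lambda>(m, l).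
     let w = map (\<lambda>y. if m \<le> y then y + 1 else y) \<rho>
     in take (l - 1) w @ m # drop (l - 1) w)"

definition infeasible :: "nat list \<Rightarrow> nat \<times> nat \<Rightarrow> bool" where
  "infeasible \<rho> = (\<lambda>(m, l).
     \<exists>(i, j, k) \<in> occs132 (insert_cell \<rho> (m, l)). l - 1 \<in> {i, j, k})"

definition feasible_cells :: "nat list \<Rightarrow> (nat \<times> nat) set" where
  "feasible_cells \<rho> =
     {c \<in> {1..length \<rho>} \<times> {1..length \<rho> + 1}. \<not> infeasible \<rho> c}"

definition cell_prec :: "nat \<times> nat \<Rightarrow> nat \<times> nat \<Rightarrow> bool" where
  "cell_prec = (\<lambda>(m, l) (m', l'). (m, l) \<noteq> (m', l') \<and> m \<ge> m' \<and> l \<le> l')"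

definition num_feasible :: "nat list \<Rightarrow> nat" where
  "num_feasible \<rho> = card (feasible_cells \<rho>)"

text \<open>
  The feasible cells in increasing order.  The list is unique since \<^const>\<open>cell_prec\<close> is a strict
  partial order, and it exists for a kernel permutation \<open>\<rho>\<close> since the feasible cells are then
  linearly ordered.
\<close>

definition cell_list :: "nat list \<Rightarrow> (nat \<times> nat) list" where
  "cell_list \<rho> = (THE cs. set cs = feasible_cells \<rho> \<and> sorted_wrt cell_prec cs)"

text \<open>
  The number of entries of \<open>\<rho>\<close> that are above-left or below-right of the feasible cell with
  0-based index \<open>j\<close>.
\<close>

definition lcount :: "nat list \<Rightarrow> nat \<Rightarrow> nat" where
  "lcount \<rho> j =
     (case cell_list \<rho> ! j of (m, l) \<Rightarrow>
        card {k \<in> {1..length \<rho>}.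
                (\<not> \<rho> ! (k - 1) < m \<and> k < l) \<or> (\<rho> ! (k - 1) < m \<and> \<not> k < l)})"


definition bit_vectors :: "nat \<Rightarrow> nat list set" where
  "bit_vectors f = {v. length v = f \<and> set v \<subseteq> {0, 1}}"

definition X_set :: "nat list \<Rightarrow> int \<Rightarrow> nat list set" where
  "X_set \<rho> \<epsilon> = {v \<in> bit_vectors (num_feasible \<rho>). (-1) ^ (sum_list v + length \<rho>) = \<epsilon>}"

definition Y_set :: "nat list \<Rightarrow> int \<Rightarrow> nat list set" where
  "Y_set \<rho> \<epsilon> = {v \<in> bit_vectors (num_feasible \<rho>). (-1) ^ sum_list v = \<epsilon>}"

definition z_sign :: "nat list \<Rightarrow> nat list \<Rightarrow> int" where
  "z_sign \<rho> v =
     (-1) ^ ((\<Sum>j < num_feasible \<rho>. \<Sum>i < j. v ! i * v ! j)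
             + (\<Sum>j < num_feasible \<rho>. lcount \<rho> j * v ! j)) * word_sign \<rho>"

definition L_gf :: "nat list \<Rightarrow> nat list \<Rightarrow> nat \<Rightarrow> nat \<Rightarrow> rat fps" where
  "L_gf \<rho> rs a b =
     (\<Sum>v \<in> X_set \<rho> ((-1) ^ a). \<Sum>u \<in> Y_set \<rho> ((-1) ^ b * z_sign \<rho> v).
        \<Prod>j < num_feasible \<rho>. H_gf (rs ! j) (v ! j) (u ! j))"

text \<open>
  The tuples with \<open>r\<^sub>1 + \<dots> + r\<^sub>f = r - c(\<rho>)\<close>.  Writing this as an addition yields the empty set,
  as it should be, if \<open>c(\<rho>) > r\<close>, whereas subtraction on \<^typ>\<open>nat\<close> would truncate.
\<close>

definition distributions :: "nat \<Rightarrow> nat list \<Rightarrow> nat list set" where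
  "distributions r \<rho> = {rs. length rs = num_feasible \<rho> \<and> sum_list rs + num132 \<rho> = r}"

end

theory Submission
  imports Defs
begin

text \<open>
  Let \<open>K\<close> be the kernel of \<open>\<pi>\<close>, with shape \<open>\<rho>\<close>.  The entries of \<open>\<rho>\<close> below-left of a feasible cell are
  closed under occurrences of 132 and miss the maximal entry, so by connectedness there are none.
  Hence the feasible cells run from upper left to lower right, and the non-kernel entries in
  different cells are decreasing relative to each other.  Therefore \<open>\<pi>\<close> is determined by \<open>\<rho>\<close> and the
  permutations \<open>\<pi>\<^sup>j\<close> in the feasible cells, which are arbitrary.  Every occurrence of 132 lies in the
  kernel or in one cell.  With \<open>n\<^sub>j\<close> the size of \<open>\<pi>\<^sup>j\<close>, the inversions of \<open>\<pi>\<close> are those of \<open>\<rho>\<close> and of the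
  \<open>\<pi>\<^sup>j\<close>, together with \<open>n\<^sub>i n\<^sub>j\<close> for each \<open>i < j\<close> and \<open>l\<^sub>j n\<^sub>j\<close> for each \<open>j\<close>.  Only the parities of the
  \<open>n\<^sub>j\<close> and the signs of the \<open>\<pi>\<^sup>j\<close> matter for the sign of \<open>\<pi>\<close>.  A connected set of \<open>c\<close> triples covers
  at most \<open>2c + 1\<close> entries, so \<open>K\<^sub>2\<^sub>r\<^sub>+\<^sub>1\<close> contains all kernel shapes of capacity at most \<open>r\<close>.
\<close>

section \<open>Permutations as planar point sets\<close>

text \<open>Splitting a word into its kernel and its cells renumbers positions and values in every
  part. To avoid this, the proof works with finite planar point sets in which no two points share an
  abscissa or an ordinate. A part is then a plain subset that keeps its coordinates, and
  \<open>word_of\<close> standardizes only at the end. The decomposition must be shown injective and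
  surjective. Injectivity holds because the rank of every point can be computed from the shape and
  the cell words alone. Surjectivity needs an inflation built by hand, and its kernel has to be
  recognized: nothing says in advance that the chosen copy of \<rho> is the kernel. Both directions
  therefore share the locale \<open>layout\<close>, which assumes only feasible cells in decreasing
  position and derives that no occurrence crosses the parts. The bound 2c + 1 comes from growing a
  component triple by triple: each new triple meets the part already built and so adds at most two
  entries. Smaller shapes also occur in size exactly 2r + 1, by padding one feasible cell.\<close>

definition perm_words :: "nat list set" where
  "perm_words = {w. distinct w \<and> set w = {1..length w}}"

lemma permutations_of_set_iff:
  "w \<in> permutations_of_set {1..n} \<longleftrightarrow> w \<in> perm_words \<and> length w = n"
proof -
  have "length w = n" if "distinct w" "set w = {1..n}"
    using distinct_card[OF that(1)] that(2) by simp
  then show ?thesis unfolding permutations_of_set_def perm_words_def by blast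
qed

definition generic :: "(nat \<times> nat) set \<Rightarrow> bool" where
  "generic A \<longleftrightarrow> finite A \<and> inj_on fst A \<and> inj_on snd A"

text \<open>The point may lie outside \<open>A\<close>. Its ranks then locate it between the grid
  lines through the points of \<open>A\<close>, which is how the cells of the kernel arise.\<close>

definition xrank :: "(nat \<times> nat) set \<Rightarrow> nat \<times> nat \<Rightarrow> nat" where
  "xrank A p = card {q \<in> A. fst q < fst p}"

definition yrank :: "(nat \<times> nat) set \<Rightarrow> nat \<times> nat \<Rightarrow> nat" where
  "yrank A p = card {q \<in> A. snd q < snd p}"

text \<open>Ranks start at 0, as list positions do, but values of a word start at 1; hence the
  asymmetric \<open>Suc\<close>.\<close>

definition norm_pt :: "(nat \<times> nat) set \<Rightarrow> nat \<times> nat \<Rightarrow> nat \<times> nat" where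
  "norm_pt A p = (xrank A p, Suc (yrank A p))"

definition pts :: "nat list \<Rightarrow> (nat \<times> nat) set" where
  "pts w = {(i, w ! i) | i. i < length w}"

definition word_of :: "(nat \<times> nat) set \<Rightarrow> nat list" where
  "word_of A = map (\<lambda>i. Suc (yrank A (inv_into A (xrank A) i))) [0..<card A]"

lemma generic_subset: "generic A \<Longrightarrow> B \<subseteq> A \<Longrightarrow> generic B"
  unfolding generic_def using finite_subset inj_on_subset by blast

lemma generic_fst_eq: "generic A \<Longrightarrow> p \<in> A \<Longrightarrow> q \<in> A \<Longrightarrow> fst p = fst q \<longleftrightarrow> p = q"
  unfolding generic_def by (meson inj_onD)

lemma generic_snd_eq: "generic A \<Longrightarrow> p \<in> A \<Longrightarrow> q \<in> A \<Longrightarrow> snd p = snd q \<longleftrightarrow> p = q"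
  unfolding generic_def by (meson inj_onD)

lemma generic_finite: "generic A \<Longrightarrow> finite A"
  unfolding generic_def by auto

text \<open>If \<open>p\<close> is left of \<open>q\<close>, then \<open>p\<close> itself is counted
  for \<open>q\<close> but not for \<open>p\<close>; otherwise the counted sets are included the
  other way round. Membership is asked of \<open>p\<close> only, so that a kernel point can be
  compared with a point outside the kernel.\<close>

lemma xrank_less_iff:
  assumes "finite A" "p \<in> A"
  shows "xrank A p < xrank A q \<longleftrightarrow> fst p < fst q"
proof
  assume "fst p < fst q"
  then have "{r \<in> A. fst r < fst p} \<subset> {r \<in> A. fst r < fst q}" using assms by auto
  then show "xrank A p < xrank A q" unfolding xrank_def using assms by (intro psubset_card_mono) auto
next
  assume *: "xrank A p < xrank A q"
  show "fst p < fst q"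
  proof (rule ccontr)
    assume "\<not> fst p < fst q"
    then have "xrank A q \<le> xrank A p" unfolding xrank_def using assms by (intro card_mono) auto
    with * show False by simp
  qed
qed

lemma yrank_less_iff:
  assumes "finite A" "p \<in> A"
  shows "yrank A p < yrank A q \<longleftrightarrow> snd p < snd q"
proof
  assume "snd p < snd q"
  then have "{r \<in> A. snd r < snd p} \<subset> {r \<in> A. snd r < snd q}" using assms by auto
  then show "yrank A p < yrank A q" unfolding yrank_def using assms by (intro psubset_card_mono) auto
next
  assume *: "yrank A p < yrank A q"
  show "snd p < snd q"
  proof (rule ccontr)
    assume "\<not> snd p < snd q"
    then have "yrank A q \<le> yrank A p" unfolding yrank_def using assms by (intro card_mono) auto
    with * show False by simp
  qed
qed

lemma bij_betw_xrank:
  assumes "generic A" shows "bij_betw (xrank A) A {..<card A}"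
proof -
  have fin: "finite A" using assms by (rule generic_finite)
  have inj: "inj_on (xrank A) A"
  proof (rule inj_onI)
    fix p q assume "p \<in> A" "q \<in> A" "xrank A p = xrank A q"
    then have "fst p = fst q" using xrank_less_iff[OF fin] by (metis less_irrefl nat_neq_iff)
    then show "p = q" using generic_fst_eq[OF assms \<open>p \<in> A\<close> \<open>q \<in> A\<close>] by simp
  qed
  have "xrank A ` A \<subseteq> {..<card A}"
  proof
    fix y assume "y \<in> xrank A ` A"
    then obtain p where p: "p \<in> A" "y = xrank A p" by auto
    have "{q \<in> A. fst q < fst p} \<subset> A" using p by auto
    then have "y < card A" unfolding p(2) xrank_def by (intro psubset_card_mono fin)
    then show "y \<in> {..<card A}" by simp
  qed
  moreover have "card (xrank A ` A) = card {..<card A}" using inj by (simp add: card_image)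
  ultimately show ?thesis unfolding bij_betw_def using inj by (metis card_subset_eq finite_lessThan)
qed

lemma bij_betw_yrank:
  assumes "generic A" shows "bij_betw (yrank A) A {..<card A}"
proof -
  have fin: "finite A" using assms by (rule generic_finite)
  have inj: "inj_on (yrank A) A"
  proof (rule inj_onI)
    fix p q assume "p \<in> A" "q \<in> A" "yrank A p = yrank A q"
    then have "snd p = snd q" using yrank_less_iff[OF fin] by (metis less_irrefl nat_neq_iff)
    then show "p = q" using generic_snd_eq[OF assms \<open>p \<in> A\<close> \<open>q \<in> A\<close>] by simp
  qed
  have "yrank A ` A \<subseteq> {..<card A}"
  proof
    fix y assume "y \<in> yrank A ` A"
    then obtain p where p: "p \<in> A" "y = yrank A p" by auto
    have "{q \<in> A. snd q < snd p} \<subset> A" using p by auto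
    then have "y < card A" unfolding p(2) yrank_def by (intro psubset_card_mono fin)
    then show "y \<in> {..<card A}" by simp
  qed
  moreover have "card (yrank A ` A) = card {..<card A}" using inj by (simp add: card_image)
  ultimately show ?thesis unfolding bij_betw_def using inj by (metis card_subset_eq finite_lessThan)
qed

lemma length_word_of [simp]: "length (word_of A) = card A"
  by (simp add: word_of_def)

lemma word_of_nth_xrank:
  assumes "generic A" "p \<in> A"
  shows "word_of A ! xrank A p = Suc (yrank A p)"
proof -
  have "xrank A p < card A" using bij_betw_xrank[OF assms(1)] assms(2) by (auto simp: bij_betw_def)
  moreover have "inv_into A (xrank A) (xrank A p) = p"
    using bij_betw_xrank[OF assms(1)] assms(2) by (simp add: bij_betw_def)
  ultimately show ?thesis by (simp add: word_of_def)
qed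

lemma pts_word_of:
  assumes "generic A" shows "pts (word_of A) = norm_pt A ` A"
proof -
  have "pts (word_of A) = (\<lambda>i. (i, word_of A ! i)) ` {..<card A}" by (auto simp: pts_def)
  also have "\<dots> = (\<lambda>i. (i, word_of A ! i)) ` xrank A ` A"
    using bij_betw_xrank[OF assms] by (simp add: bij_betw_def)
  also have "\<dots> = norm_pt A ` A"
    by (auto simp: word_of_nth_xrank[OF assms] norm_pt_def image_iff)
  finally show ?thesis .
qed

lemma word_of_perm_words:
  assumes "generic A" shows "word_of A \<in> perm_words"
proof -
  have "set (word_of A) = snd ` pts (word_of A)" by (force simp: pts_def set_conv_nth)
  also have "\<dots> = Suc ` yrank A ` A" unfolding pts_word_of[OF assms] norm_pt_def by force
  also have "\<dots> = {1..card A}"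
    using bij_betw_yrank[OF assms] by (simp add: bij_betw_def image_Suc_lessThan)
  finally have *: "set (word_of A) = {1..card A}" .
  then have "card (set (word_of A)) = length (word_of A)" by simp
  then show ?thesis using * card_distinct[of "word_of A"] unfolding perm_words_def by auto
qed

lemma pts_inject: "pts w = pts w' \<Longrightarrow> w = w'"
proof (rule nth_equalityI)
  assume *: "pts w = pts w'"
  have "fst ` pts v = {..<length v}" for v by (force simp: pts_def)
  then show l: "length w = length w'" using * by (metis lessThan_eq_iff)
  fix i assume "i < length w"
  then have "(i, w ! i) \<in> pts w'" unfolding *[symmetric] by (auto simp: pts_def)
  then show "w ! i = w' ! i" by (auto simp: pts_def)
qed

lemma generic_pts:
  assumes "distinct w" shows "generic (pts w)"
proof -
  have "pts w = (\<lambda>i. (i, w ! i)) ` {..<length w}" by (auto simp: pts_def)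
  then show ?thesis using assms by (auto simp: generic_def inj_on_def nth_eq_iff_index_eq)
qed

lemma card_pts: "card (pts w) = length w"
proof -
  have "pts w = (\<lambda>i. (i, w ! i)) ` {..<length w}" by (auto simp: pts_def)
  moreover have "inj_on (\<lambda>i. (i, w ! i)) {..<length w}" by (auto simp: inj_on_def)
  ultimately show ?thesis by (metis card_image card_lessThan)
qed

lemma xrank_pts:
  assumes "i \<le> length w" shows "xrank (pts w) (i, y) = i"
proof -
  have "{q \<in> pts w. fst q < i} = (\<lambda>j. (j, w ! j)) ` {..<i}" using assms by (auto simp: pts_def)
  moreover have "inj_on (\<lambda>j. (j, w ! j)) {..<i}" by (auto simp: inj_on_def)
  ultimately show ?thesis by (simp add: xrank_def card_image)
qed

lemma yrank_pts:
  assumes "w \<in> perm_words" "1 \<le> y" "y \<le> Suc (length w)"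
  shows "yrank (pts w) (i, y) = y - 1"
proof -
  have d: "distinct w" "set w = {1..length w}" using assms by (auto simp: perm_words_def)
  have "snd ` {q \<in> pts w. snd q < y} = {z \<in> set w. z < y}"
    by (force simp: pts_def set_conv_nth)
  also have "\<dots> = {1..<y}" unfolding d(2) using assms(3) by auto
  finally have img: "snd ` {q \<in> pts w. snd q < y} = {1..<y}" .
  have "inj_on snd {q \<in> pts w. snd q < y}"
    using generic_pts[OF d(1)] unfolding generic_def by (auto intro: inj_on_subset)
  then have "card {q \<in> pts w. snd q < y} = card {1..<y}"
    using img card_image by fastforce
  then show ?thesis by (simp add: yrank_def)
qed

lemma norm_pt_pts:
  assumes "w \<in> perm_words" "p \<in> pts w"
  shows "norm_pt (pts w) p = p"
proof -
  obtain i where i: "p = (i, w ! i)" "i < length w" using assms by (auto simp: pts_def)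
  then have "w ! i \<in> {1..length w}" using assms(1) nth_mem by (auto simp: perm_words_def)
  then show ?thesis
    using i xrank_pts[of i w] yrank_pts[OF assms(1), of "w ! i"] by (simp add: norm_pt_def)
qed

lemma word_of_pts:
  assumes "w \<in> perm_words" shows "word_of (pts w) = w"
proof (rule pts_inject)
  have "generic (pts w)" using assms by (simp add: perm_words_def generic_pts)
  then show "pts (word_of (pts w)) = pts w"
    using norm_pt_pts[OF assms] by (simp add: pts_word_of)
qed

section \<open>Occurrences and inversions of point sets, and their invariance under
  standardization\<close>

definition occs :: "(nat \<times> nat) set \<Rightarrow> ((nat \<times> nat) \<times> (nat \<times> nat) \<times> (nat \<times> nat)) set" where
  "occs A = {(p, q, r). p \<in> A \<and> q \<in> A \<and> r \<in> A \<and> fst p < fst q \<and> fst q < fst r \<and>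
     snd p < snd r \<and> snd r < snd q}"

definition invs :: "(nat \<times> nat) set \<Rightarrow> ((nat \<times> nat) \<times> (nat \<times> nat)) set" where
  "invs A = {(p, q). p \<in> A \<and> q \<in> A \<and> fst p < fst q \<and> snd q < snd p}"

lemma card_occs_pts: "card (occs (pts w)) = num132 w"
proof -
  let ?h = "\<lambda>(i, j, k). ((i, w ! i), (j, w ! j), (k, w ! k))"
  have "occs (pts w) = ?h ` occs132 w"
  proof (intro equalityI subsetI)
    fix t assume "t \<in> occs (pts w)"
    then obtain i j k where "t = ?h (i, j, k)" "(i, j, k) \<in> occs132 w"
      by (auto simp: occs_def occs132_def pts_def)
    then show "t \<in> ?h ` occs132 w" by (rule image_eqI)
  qed (auto simp: occs_def occs132_def pts_def)
  moreover have "inj_on ?h (occs132 w)" by (auto simp: inj_on_def)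
  ultimately show ?thesis by (simp add: card_image num132_def)
qed

lemma card_invs_pts: "card (invs (pts w)) = card (inversions w)"
proof -
  let ?h = "\<lambda>(i, j). ((i, w ! i), (j, w ! j))"
  have "invs (pts w) = ?h ` inversions w"
  proof (intro equalityI subsetI)
    fix t assume "t \<in> invs (pts w)"
    then obtain i j where "t = ?h (i, j)" "(i, j) \<in> inversions w"
      by (auto simp: invs_def inversions_def pts_def)
    then show "t \<in> ?h ` inversions w" by (rule image_eqI)
  qed (auto simp: invs_def inversions_def pts_def)
  moreover have "inj_on ?h (inversions w)" by (auto simp: inj_on_def)
  ultimately show ?thesis by (simp add: card_image)
qed

lemma fst_norm_pt_less:
  "generic A \<Longrightarrow> p \<in> A \<Longrightarrow> fst (norm_pt A p) < fst (norm_pt A q) \<longleftrightarrow> fst p < fst q"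
  by (simp add: norm_pt_def xrank_less_iff generic_finite)

lemma snd_norm_pt_less:
  "generic A \<Longrightarrow> p \<in> A \<Longrightarrow> snd (norm_pt A p) < snd (norm_pt A q) \<longleftrightarrow> snd p < snd q"
  by (simp add: norm_pt_def yrank_less_iff generic_finite)

lemma inj_on_norm_pt:
  assumes "generic A" shows "inj_on (norm_pt A) A"
proof (rule inj_onI)
  fix p q assume "p \<in> A" "q \<in> A" "norm_pt A p = norm_pt A q"
  then show "p = q" using bij_betw_xrank[OF assms]
    unfolding bij_betw_def norm_pt_def by (auto dest: inj_onD)
qed

lemma occs_norm_pt:
  assumes "generic A"
  shows "occs (norm_pt A ` A) = (\<lambda>(p, q, r). (norm_pt A p, norm_pt A q, norm_pt A r)) ` occs A"
  (is "?L = ?h ` ?R")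
proof (intro equalityI subsetI)
  fix t assume "t \<in> ?L"
  then obtain p q r where "p \<in> A" "q \<in> A" "r \<in> A" and t: "t = (norm_pt A p, norm_pt A q, norm_pt A r)"
    by (auto simp: occs_def)
  then have "(p, q, r) \<in> occs A" using \<open>t \<in> ?L\<close> assms
    by (simp add: occs_def fst_norm_pt_less snd_norm_pt_less)
  then show "t \<in> ?h ` ?R" unfolding t by force
next
  fix t assume "t \<in> ?h ` ?R"
  then show "t \<in> ?L" using assms by (auto simp: occs_def fst_norm_pt_less snd_norm_pt_less)
qed

lemma num132_word_of:
  assumes "generic A" shows "num132 (word_of A) = card (occs A)"
proof -
  have "inj_on (\<lambda>(p, q, r). (norm_pt A p, norm_pt A q, norm_pt A r)) (occs A)"
    using inj_on_norm_pt[OF assms] by (auto simp: inj_on_def occs_def)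
  then show ?thesis
    by (simp add: card_occs_pts[symmetric] pts_word_of assms occs_norm_pt card_image)
qed

lemma card_inversions_word_of:
  assumes "generic A" shows "card (inversions (word_of A)) = card (invs A)"
proof -
  let ?h = "\<lambda>(p, q). (norm_pt A p, norm_pt A q)"
  have "invs (norm_pt A ` A) = ?h ` invs A"
  proof (intro equalityI subsetI)
    fix t assume t': "t \<in> invs (norm_pt A ` A)"
    then obtain p q where "p \<in> A" "q \<in> A" and t: "t = (norm_pt A p, norm_pt A q)"
      by (auto simp: invs_def)
    then have "(p, q) \<in> invs A" using t' assms
      by (simp add: invs_def fst_norm_pt_less snd_norm_pt_less)
    then show "t \<in> ?h ` invs A" unfolding t by force
  next
    fix t assume "t \<in> ?h ` invs A"
    then show "t \<in> invs (norm_pt A ` A)" using assms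
      by (auto simp: invs_def fst_norm_pt_less snd_norm_pt_less)
  qed
  moreover have "inj_on ?h (invs A)"
    using inj_on_norm_pt[OF assms] by (auto simp: inj_on_def invs_def)
  ultimately show ?thesis
    by (simp add: card_invs_pts[symmetric] pts_word_of assms card_image)
qed

section \<open>The kernel of a point set\<close>

text \<open>Closed sets are the unions of connected components of the bipartite graph, so that
  \<open>kset A\<close> is the component of the maximal point.\<close>

definition closed_in :: "(nat \<times> nat) set \<Rightarrow> (nat \<times> nat) set \<Rightarrow> bool" where
  "closed_in A S \<longleftrightarrow> S \<subseteq> A \<and>
     (\<forall>p q r. (p, q, r) \<in> occs A \<longrightarrow> p \<in> S \<or> q \<in> S \<or> r \<in> S \<longrightarrow> p \<in> S \<and> q \<in> S \<and> r \<in> S)"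

text \<open>A set instead of a point, so that the empty point set needs no separate treatment. For
  nonempty generic \<open>A\<close> it is a singleton.\<close>

definition top_pts :: "(nat \<times> nat) set \<Rightarrow> (nat \<times> nat) set" where
  "top_pts A = {p \<in> A. \<forall>q \<in> A. snd q \<le> snd p}"

definition kset :: "(nat \<times> nat) set \<Rightarrow> (nat \<times> nat) set" where
  "kset A = \<Inter> {S. closed_in A S \<and> top_pts A \<subseteq> S}"

definition conn :: "(nat \<times> nat) set \<Rightarrow> bool" where
  "conn A \<longleftrightarrow> kset A = A"

lemma closed_inI:
  assumes "S \<subseteq> A"
    and "\<And>p q r. (p, q, r) \<in> occs A \<Longrightarrow> p \<in> S \<or> q \<in> S \<or> r \<in> S \<Longrightarrow> p \<in> S \<and> q \<in> S \<and> r \<in> S"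
  shows "closed_in A S"
  using assms unfolding closed_in_def by blast

lemma closed_inD:
  "closed_in A S \<Longrightarrow> (p, q, r) \<in> occs A \<Longrightarrow> p \<in> S \<or> q \<in> S \<or> r \<in> S \<Longrightarrow> p \<in> S \<and> q \<in> S \<and> r \<in> S"
  unfolding closed_in_def by blast

lemma top_pts_subset: "top_pts A \<subseteq> A" by (auto simp: top_pts_def)

lemma kset_least: "closed_in A S \<Longrightarrow> top_pts A \<subseteq> S \<Longrightarrow> kset A \<subseteq> S"
  unfolding kset_def by blast

lemma kset_subset: "kset A \<subseteq> A"
  by (rule kset_least[OF closed_inI]) (auto simp: top_pts_def occs_def)

lemma closed_in_kset: "closed_in A (kset A)"
proof (rule closed_inI[OF kset_subset])
  fix p q r assume o: "(p, q, r) \<in> occs A" "p \<in> kset A \<or> q \<in> kset A \<or> r \<in> kset A"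
  show "p \<in> kset A \<and> q \<in> kset A \<and> r \<in> kset A"
    using o(2) closed_inD[OF _ o(1)] unfolding kset_def by blast
qed

lemma top_pts_subset_kset: "top_pts A \<subseteq> kset A"
  unfolding kset_def by blast

lemma top_pts_nonempty:
  assumes "finite A" "A \<noteq> {}" shows "top_pts A \<noteq> {}"
proof -
  have "Max (snd ` A) \<in> snd ` A" using assms by simp
  then obtain p where "p \<in> A" "snd p = Max (snd ` A)" by (metis imageE)
  then have "p \<in> top_pts A" using assms by (auto simp: top_pts_def)
  then show ?thesis by auto
qed

lemma conn_closed_eq: "conn A \<Longrightarrow> closed_in A S \<Longrightarrow> top_pts A \<subseteq> S \<Longrightarrow> S = A"
  unfolding conn_def using kset_least[of A S] unfolding closed_in_def by blast

lemma occs_subset_iff: "B \<subseteq> A \<Longrightarrow> (p, q, r) \<in> occs B \<longleftrightarrow> (p, q, r) \<in> occs A \<and> p \<in> B \<and> q \<in> B \<and> r \<in> B"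
  unfolding occs_def by auto

lemma finite_occs: "finite A \<Longrightarrow> finite (occs A)"
  by (rule finite_subset[of _ "A \<times> A \<times> A"]) (auto simp: occs_def)

text \<open>The kernel is closed in \<open>A\<close>, so an occurrence of \<open>A\<close> meeting a
  subset of the kernel lies in the kernel altogether. Hence a closed subset of the kernel is closed
  in \<open>A\<close>, and minimality of \<open>kset A\<close> applies to it.\<close>

lemma conn_kset: "conn (kset A)"
proof -
  let ?K = "kset A" and ?T = "kset (kset A)"
  have "closed_in A ?T"
  proof (rule closed_inI)
    show "?T \<subseteq> A" using kset_subset[of A] kset_subset[of ?K] by auto
    fix p q r assume o: "(p, q, r) \<in> occs A" "p \<in> ?T \<or> q \<in> ?T \<or> r \<in> ?T"
    then have "p \<in> ?K \<and> q \<in> ?K \<and> r \<in> ?K"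
      using kset_subset[of ?K] closed_inD[OF closed_in_kset o(1)] by blast
    then have "(p, q, r) \<in> occs ?K" using o(1) occs_subset_iff[OF kset_subset[of A]] by auto
    from closed_inD[OF closed_in_kset this o(2)] show "p \<in> ?T \<and> q \<in> ?T \<and> r \<in> ?T" .
  qed
  moreover have "top_pts A \<subseteq> ?T"
  proof -
    have "top_pts A \<subseteq> top_pts ?K"
      using top_pts_subset_kset[of A] kset_subset[of A] by (auto simp: top_pts_def)
    then show ?thesis using top_pts_subset_kset[of ?K] by auto
  qed
  ultimately show ?thesis unfolding conn_def using kset_least[of A ?T] kset_subset[of ?K] by auto
qed

lemma norm_pt_in_top_pts:
  assumes "generic A" "p \<in> A"
  shows "norm_pt A p \<in> top_pts (norm_pt A ` A) \<longleftrightarrow> p \<in> top_pts A"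
  using assms by (auto simp: top_pts_def not_less[symmetric] snd_norm_pt_less)

lemma occs_norm_pt_iff:
  assumes "generic A" "p \<in> A" "q \<in> A" "r \<in> A"
  shows "(norm_pt A p, norm_pt A q, norm_pt A r) \<in> occs (norm_pt A ` A) \<longleftrightarrow> (p, q, r) \<in> occs A"
  using assms by (auto simp: occs_def fst_norm_pt_less snd_norm_pt_less)

text \<open>\<open>norm_pt A\<close> preserves the order of both coordinates, hence occurrences and
  maxima. Each inclusion is minimality of one kernel, tested against the image or the preimage of
  the other.\<close>

lemma kset_norm_pt:
  assumes A: "generic A" shows "kset (norm_pt A ` A) = norm_pt A ` kset A"
proof
  let ?g = "norm_pt A"
  have inj: "?g x \<in> ?g ` kset A \<longleftrightarrow> x \<in> kset A" if "x \<in> A" for x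
    using inj_on_image_mem_iff[OF inj_on_norm_pt[OF A] that kset_subset] .
  show "kset (?g ` A) \<subseteq> ?g ` kset A"
  proof (rule kset_least[OF closed_inI])
    show "?g ` kset A \<subseteq> ?g ` A" using kset_subset by blast
    fix p' q' r' assume o: "(p', q', r') \<in> occs (?g ` A)"
      "p' \<in> ?g ` kset A \<or> q' \<in> ?g ` kset A \<or> r' \<in> ?g ` kset A"
    then obtain p q r where pqr: "(p, q, r) \<in> occs A" "p' = ?g p" "q' = ?g q" "r' = ?g r"
      using occs_norm_pt[OF A] by auto
    then have "p \<in> A" "q \<in> A" "r \<in> A" by (auto simp: occs_def)
    then have "p \<in> kset A \<or> q \<in> kset A \<or> r \<in> kset A" using o(2) inj pqr(2-4) by simp
    from closed_inD[OF closed_in_kset pqr(1) this]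
    show "p' \<in> ?g ` kset A \<and> q' \<in> ?g ` kset A \<and> r' \<in> ?g ` kset A" using pqr(2-4) by simp
  next
    show "top_pts (?g ` A) \<subseteq> ?g ` kset A"
    proof
      fix x assume x: "x \<in> top_pts (?g ` A)"
      then obtain p where p: "p \<in> A" "x = ?g p" using top_pts_subset[of "?g ` A"] by auto
      then have "p \<in> top_pts A" using x norm_pt_in_top_pts[OF A p(1)] by simp
      then show "x \<in> ?g ` kset A" using top_pts_subset_kset[of A] p(2) by auto
    qed
  qed
  have "kset A \<subseteq> {p \<in> A. ?g p \<in> kset (?g ` A)}"
  proof (rule kset_least[OF closed_inI])
    fix p q r assume o: "(p, q, r) \<in> occs A"
      "p \<in> {p \<in> A. ?g p \<in> kset (?g ` A)} \<or> q \<in> {p \<in> A. ?g p \<in> kset (?g ` A)} \<or>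
       r \<in> {p \<in> A. ?g p \<in> kset (?g ` A)}"
    then have "p \<in> A" "q \<in> A" "r \<in> A" by (auto simp: occs_def)
    moreover from this have "(?g p, ?g q, ?g r) \<in> occs (?g ` A)"
      using occs_norm_pt_iff[OF A] o(1) by simp
    note closed_inD[OF closed_in_kset this]
    ultimately show "p \<in> {p \<in> A. ?g p \<in> kset (?g ` A)} \<and> q \<in> {p \<in> A. ?g p \<in> kset (?g ` A)} \<and>
       r \<in> {p \<in> A. ?g p \<in> kset (?g ` A)}"
      using o(2) by simp
  next
    show "top_pts A \<subseteq> {p \<in> A. ?g p \<in> kset (?g ` A)}"
    proof
      fix p assume p: "p \<in> top_pts A"
      then have "p \<in> A" using top_pts_subset[of A] by auto
      with p have "?g p \<in> top_pts (?g ` A)" using norm_pt_in_top_pts[OF A] by simp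
      then show "p \<in> {p \<in> A. ?g p \<in> kset (?g ` A)}"
        using \<open>p \<in> A\<close> top_pts_subset_kset[of "?g ` A"] by auto
    qed
  qed auto
  then show "?g ` kset A \<subseteq> kset (?g ` A)" by auto
qed

lemma conn_word_of_iff:
  assumes A: "generic A" shows "conn (pts (word_of A)) \<longleftrightarrow> conn A"
  unfolding pts_word_of[OF A] conn_def kset_norm_pt[OF A]
  using inj_on_image_eq_iff[OF inj_on_norm_pt[OF A] kset_subset order_refl] .

text \<open>Take a largest \<open>S\<close> containing the maximum and satisfying the bound with its
  own occurrences. If an occurrence met \<open>S\<close> without lying in it, adding its points
  would cost at most two points and gain at least one occurrence, so a larger set would satisfy the
  bound. Hence \<open>S\<close> is closed, and connectedness makes it all of
  \<open>A\<close>.\<close>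

lemma card_conn_le:
  assumes A: "generic A" "conn A" shows "card A \<le> 2 * card (occs A) + 1"
proof -
  have fin: "finite A" using A(1) by (rule generic_finite)
  define P where "P S \<longleftrightarrow> top_pts A \<subseteq> S \<and> S \<subseteq> A \<and> card S \<le> 2 * card (occs S) + 1" for S
  have "card (top_pts A) \<le> 1"
  proof -
    have "p = q" if "p \<in> top_pts A" "q \<in> top_pts A" for p q
    proof -
      have "snd p = snd q" "p \<in> A" "q \<in> A" using that by (simp_all add: top_pts_def le_antisym)
      then show ?thesis using generic_snd_eq[OF A(1)] by simp
    qed
    then have "\<forall>p \<in> top_pts A. \<forall>q \<in> top_pts A. p = q" by blast
    then show ?thesis using finite_subset[OF top_pts_subset fin] by (simp add: card_le_Suc0_iff_eq)
  qed
  then have "P (top_pts A)" unfolding P_def using top_pts_subset by auto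
  moreover have "\<forall>S. P S \<longrightarrow> card S < Suc (card A)" using card_mono[OF fin] by (auto simp: P_def less_Suc_eq_le)
  ultimately obtain S where S: "P S" and max: "\<And>T. P T \<Longrightarrow> card T \<le> card S"
    using ex_has_greatest_nat[of P "top_pts A" card "Suc (card A)"] by blast
  have finS: "finite S" using S fin finite_subset unfolding P_def by blast
  have "closed_in A S"
  proof (rule closed_inI, goal_cases)
    case 1 then show ?case using S by (simp add: P_def)
  next
    case (2 p q r)
    show ?case
    proof (rule ccontr)
      assume n: "\<not> (p \<in> S \<and> q \<in> S \<and> r \<in> S)"
      let ?T = "S \<union> {p, q, r}"
      have "card ?T \<le> card S + 2"
      proof -
        have "card (?T - S) \<le> 2"
        proof -
          have "?T - S \<subseteq> {p, q} \<or> ?T - S \<subseteq> {q, r} \<or> ?T - S \<subseteq> {p, r}" using 2(2) by auto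
          then obtain x y where "?T - S \<subseteq> {x, y}" by blast
          then have "card (?T - S) \<le> card {x, y}" by (intro card_mono) auto
          also have "\<dots> \<le> 2" by (simp add: card_insert_if)
          finally show ?thesis .
        qed
        moreover have "card ?T = card S + card (?T - S)"
          using finS by (subst card_Un_disjoint[symmetric]) auto
        ultimately show ?thesis by simp
      qed
      moreover have "card (occs S) + 1 \<le> card (occs ?T)"
      proof -
        have "(p, q, r) \<notin> occs S" using n by (auto simp: occs_def)
        then have "card (occs S) + 1 = card (insert (p, q, r) (occs S))"
          using finite_occs[OF finS] by simp
        also have "\<dots> \<le> card (occs ?T)"
          using 2(1) finS by (intro card_mono finite_occs) (auto simp: occs_def)
        finally show ?thesis .
      qed
      moreover have "card S \<le> 2 * card (occs S) + 1" using S by (simp add: P_def)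
      ultimately have "card ?T \<le> 2 * card (occs ?T) + 1" by linarith
      moreover have "p \<in> A" "q \<in> A" "r \<in> A" using 2(1) by (auto simp: occs_def)
      ultimately have "P ?T" using S by (auto simp: P_def)
      moreover have "card S < card ?T" using n finS by (intro psubset_card_mono) auto
      ultimately show False using max by fastforce
    qed
  qed
  then have "S = A" using conn_closed_eq[OF A(2)] S by (auto simp: P_def)
  then show ?thesis using S by (simp add: P_def)
qed

section \<open>The kernel of a word as a component of the bipartite graph\<close>

lemma kernel_positions_eq:
  assumes w: "w \<in> perm_words"
  shows "kernel_positions w = {i. i < length w \<and> (i, w ! i) \<in> kset (pts w)}"
proof (intro equalityI subsetI)
  fix q assume "q \<in> kernel_positions w"
  then obtain p where q: "q < length w" and p: "p < length w" "w ! p = length w"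
    and r: "(Inl p, Inl q) \<in> (kernel_edges w \<union> (kernel_edges w)\<inverse>)\<^sup>*"
    by (auto simp: kernel_positions_def)
  \<comment> \<open>The invariant along a path of the graph: an entry vertex lies in
    \<open>kset\<close>, and an occurrence vertex has all three of its entries there.\<close>
  define good :: "nat + nat \<times> nat \<times> nat \<Rightarrow> bool" where
    "good v = (case v of Inl i \<Rightarrow> (i, w ! i) \<in> kset (pts w)
      | Inr (i, j, k) \<Rightarrow> (i, w ! i) \<in> kset (pts w) \<and> (j, w ! j) \<in> kset (pts w) \<and> (k, w ! k) \<in> kset (pts w))" for v
  have "(p, w ! p) \<in> top_pts (pts w)"
  proof -
    have "w ! i \<le> length w" if "i < length w" for i
      using w nth_mem[OF that] by (auto simp: perm_words_def)
    then show ?thesis using p by (auto simp: top_pts_def pts_def)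
  qed
  then have "good (Inl p)" using top_pts_subset_kset by (auto simp: good_def)
  from r this have "good (Inl q)"
  proof (induction rule: rtrancl_induct)
    case (step y z)
    have clos: "(i, w ! i) \<in> kset (pts w) \<and> (j, w ! j) \<in> kset (pts w) \<and> (k, w ! k) \<in> kset (pts w)"
      if "(i, j, k) \<in> occs132 w" "x \<in> {i, j, k}" "(x, w ! x) \<in> kset (pts w)" for i j k x
    proof -
      have "((i, w ! i), (j, w ! j), (k, w ! k)) \<in> occs (pts w)"
        using that(1) by (auto simp: occs_def occs132_def pts_def)
      from closed_inD[OF closed_in_kset this] show ?thesis using that by blast
    qed
    have "good y" using step by simp
    from step(2) show ?case
    proof
      assume "(y, z) \<in> kernel_edges w"
      then obtain x i j k where "y = Inl x" "z = Inr (i, j, k)" "(i, j, k) \<in> occs132 w" "x \<in> {i, j, k}"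
        unfolding kernel_edges_def by blast
      then show ?thesis using \<open>good y\<close> clos[of i j k x] by (simp add: good_def)
    next
      assume "(y, z) \<in> (kernel_edges w)\<inverse>"
      then obtain x i j k where "z = Inl x" "y = Inr (i, j, k)" "(i, j, k) \<in> occs132 w" "x \<in> {i, j, k}"
        unfolding kernel_edges_def by blast
      then show ?thesis using \<open>good y\<close> by (auto simp: good_def)
    qed
  qed
  then show "q \<in> {i. i < length w \<and> (i, w ! i) \<in> kset (pts w)}" using q by (simp add: good_def)
next
  let ?R = "(kernel_edges w \<union> (kernel_edges w)\<inverse>)\<^sup>*"
  let ?S = "{(i, w ! i) | i. i \<in> kernel_positions w}"
  \<comment> \<open>Conversely, the entries reachable from the maximum form a closed set, so they
    contain the least one.\<close>
  have "kset (pts w) \<subseteq> ?S"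
  proof (rule kset_least[OF closed_inI])
    show "?S \<subseteq> pts w" by (auto simp: pts_def kernel_positions_def)
    fix p q r assume o: "(p, q, r) \<in> occs (pts w)" and m: "p \<in> ?S \<or> q \<in> ?S \<or> r \<in> ?S"
    obtain i j k where pqr: "p = (i, w ! i)" "q = (j, w ! j)" "r = (k, w ! k)"
      and t: "(i, j, k) \<in> occs132 w"
      using o by (auto simp: occs_def occs132_def pts_def)
    have len: "i < length w" "j < length w" "k < length w" using t by (auto simp: occs132_def)
    obtain x where x: "x \<in> {i, j, k}" "x \<in> kernel_positions w" using m pqr by auto
    then obtain p0 where p0: "p0 < length w" "w ! p0 = length w" "(Inl p0, Inl x) \<in> ?R"
      by (auto simp: kernel_positions_def)
    have "(Inl x, Inr (i, j, k)) \<in> kernel_edges w" using t x(1) unfolding kernel_edges_def by blast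
    then have 1: "(Inl p0, Inr (i, j, k)) \<in> ?R" using p0(3) by (meson UnI1 rtrancl.rtrancl_into_rtrancl)
    have "y \<in> kernel_positions w" if "y \<in> {i, j, k}" for y
    proof -
      have "(Inl y, Inr (i, j, k)) \<in> kernel_edges w" using t that unfolding kernel_edges_def by blast
      then have "(Inl p0, Inl y) \<in> ?R" using 1 by (meson UnI2 converseI rtrancl.rtrancl_into_rtrancl)
      moreover have "y < length w" using that len by auto
      ultimately show ?thesis using p0(1,2) unfolding kernel_positions_def by blast
    qed
    then show "p \<in> ?S \<and> q \<in> ?S \<and> r \<in> ?S" using pqr by blast
  next
    show "top_pts (pts w) \<subseteq> ?S"
    proof
      fix p assume p: "p \<in> top_pts (pts w)"
      then obtain i where i: "p = (i, w ! i)" "i < length w" by (auto simp: top_pts_def pts_def)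
      then have "length w \<in> set w" using w by (auto simp: perm_words_def)
      then obtain j where "j < length w" "w ! j = length w" by (auto simp: in_set_conv_nth)
      moreover from this have "w ! j \<le> w ! i" using p i by (auto simp: top_pts_def pts_def)
      moreover have "w ! i \<le> length w" using w nth_mem[OF i(2)] by (auto simp: perm_words_def)
      ultimately have "w ! i = length w" by simp
      then have "i \<in> kernel_positions w" using i unfolding kernel_positions_def by blast
      then show "p \<in> ?S" using i by blast
    qed
  qed
  then show "i \<in> kernel_positions w" if "i \<in> {i. i < length w \<and> (i, w ! i) \<in> kset (pts w)}" for i
    using that by auto
qed

text \<open>A kept entry moves to the index that counts the kept positions before it. For kernel
  positions this index is the \<open>xrank\<close> in the kernel.\<close>

lemma nths_nth_card:
  assumes "i < length w" "i \<in> S"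
  shows "nths w S ! card {j \<in> S. j < i} = w ! i"
proof -
  have w: "w = take i w @ w ! i # drop (Suc i) w" using id_take_nth_drop[OF assms(1)] .
  have "nths w S = nths (take i w) S @ w ! i # nths (drop (Suc i) w) {j. Suc (j + i) \<in> S}"
    using assms by (subst w) (simp add: nths_append nths_Cons)
  moreover have "length (nths (take i w) S) = card {j \<in> S. j < i}"
    using assms by (auto simp: length_nths intro: arg_cong[where f = card])
  ultimately show ?thesis by (metis nth_append_length)
qed

lemma kernel_shape_eq:
  assumes w: "w \<in> perm_words"
  shows "kernel_shape w = word_of (kset (pts w))"
proof (rule nth_equalityI)
  let ?K = "kset (pts w)" and ?S = "kernel_positions w"
  have gw: "generic (pts w)" using w by (simp add: perm_words_def generic_pts)
  then have gK: "generic ?K" using generic_subset kset_subset by blast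
  have S: "?S = {i. i < length w \<and> (i, w ! i) \<in> ?K}" using kernel_positions_eq[OF w] .
  have K: "?K = (\<lambda>i. (i, w ! i)) ` ?S" unfolding S using kset_subset[of "pts w"] by (auto simp: pts_def)
  have "{i. i < length w \<and> i \<in> ?S} = ?S" using S by blast
  then have "length (kernel w) = card ?S" by (simp add: kernel_def length_nths)
  also have "\<dots> = card ?K" by (subst K, rule card_image[symmetric]) (auto simp: inj_on_def)
  finally have lenk: "length (kernel w) = card ?K" .
  then show "length (kernel_shape w) = length (word_of ?K)"
    by (simp add: kernel_shape_def standardize_def)
  have setk: "set (kernel w) = snd ` ?K" 
  proof -
    have "snd ` ?K = (\<lambda>i. w ! i) ` ?S" by (subst K) (simp add: image_image)
    then show ?thesis unfolding kernel_def set_nths using S by auto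
  qed
  fix x assume "x < length (kernel_shape w)"
  then have x: "x < card ?K" using lenk by (simp add: kernel_shape_def standardize_def)
  then obtain p where p: "p \<in> ?K" "x = xrank ?K p"
    using bij_betw_xrank[OF gK] unfolding bij_betw_def by blast
  have mem: "q \<in> ?K \<longleftrightarrow> (\<exists>i \<in> ?S. q = (i, w ! i))" for q by (subst K) auto
  then obtain i where i: "p = (i, w ! i)" "i \<in> ?S" using p(1) by auto
  then have "i < length w" using S by simp
  have "{q \<in> ?K. fst q < i} = (\<lambda>i. (i, w ! i)) ` {j \<in> ?S. j < i}" unfolding mem by auto
  then have "xrank ?K p = card ((\<lambda>i. (i, w ! i)) ` {j \<in> ?S. j < i})" by (simp add: xrank_def i)
  also have "\<dots> = card {j \<in> ?S. j < i}" by (rule card_image) (auto simp: inj_on_def)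
  finally have "kernel w ! x = w ! i" unfolding kernel_def p(2) using nths_nth_card[OF \<open>i < length w\<close> i(2)] by simp
  then have "kernel_shape w ! x = card {y \<in> snd ` ?K. y \<le> w ! i}"
    using x lenk by (simp add: kernel_shape_def standardize_def setk)
  \<comment> \<open>\<open>standardize\<close> also counts the value itself; this is the
    \<open>Suc\<close> in \<open>word_of\<close>.\<close>
  also have "{y \<in> snd ` ?K. y \<le> w ! i} = insert (w ! i) (snd ` {q \<in> ?K. snd q < w ! i})"
    using p(1) unfolding i(1) by force
  also have "card \<dots> = Suc (card (snd ` {q \<in> ?K. snd q < w ! i}))"
    using generic_finite[OF gK] by (subst card_insert_disjoint) auto
  also have "card (snd ` {q \<in> ?K. snd q < w ! i}) = yrank ?K p"
    unfolding yrank_def i(1) snd_conv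
    using gK by (intro card_image) (auto simp: generic_def intro: inj_on_subset)
  also have "Suc (yrank ?K p) = word_of ?K ! x" using word_of_nth_xrank[OF gK p(1)] p(2) by simp
  finally show "kernel_shape w ! x = word_of ?K ! x" .
qed

section \<open>Feasible cells\<close>

text \<open>The row comes first, as in \<open>(m, l)\<close>, although a point lists its abscissa
  first. Both ranks are raised by one because cell indices start at 1.\<close>

definition cell_of :: "(nat \<times> nat) set \<Rightarrow> nat \<times> nat \<Rightarrow> nat \<times> nat" where
  "cell_of K p = (Suc (yrank K p), Suc (xrank K p))"

text \<open>The indices of a cell \<open>(m, l)\<close> are 1-based, and so are the values of a word, but the abscissae
  in \<^term>\<open>pts w\<close> are 0-based: \<open>p\<close> is left of \<open>(m, l)\<close> iff \<open>Suc (fst p) < l\<close>, and below iff \<open>snd p < m\<close>.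
  The three disjuncts make the inserted element the first, the middle and the last entry of an
  occurrence.\<close>

definition obstructed :: "(nat \<times> nat) set \<Rightarrow> nat \<times> nat \<Rightarrow> bool" where
  "obstructed K = (\<lambda>(m, l). \<exists>p \<in> K. \<exists>q \<in> K. fst p < fst q \<and>
     (l \<le> Suc (fst p) \<and> m \<le> snd q \<and> snd q < snd p \<or>
      Suc (fst p) < l \<and> l \<le> Suc (fst q) \<and> snd p < snd q \<and> snd q < m \<or>
      Suc (fst q) < l \<and> snd p < m \<and> m \<le> snd q))"

lemma bex_pts: "(\<exists>p \<in> pts w. P p) \<longleftrightarrow> (\<exists>i < length w. P (i, w ! i))"
  by (auto simp: pts_def)

text \<open>Insertion moves an old position by \<open>emb\<close> and an old value by
  \<open>sh\<close>. Both maps are strictly increasing and skip the new position \<open>d\<close>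
  and the new value \<open>m\<close>, so each comparison in the inserted word becomes one in \<rho>
  against the borders of the cell.\<close>

lemma infeasible_iff:
  assumes "1 \<le> l" "l \<le> Suc (length \<rho>)"
  shows "infeasible \<rho> (m, l) \<longleftrightarrow> obstructed (pts \<rho>) (m, l)"
proof -
  define d where "d = l - 1"
  have d: "d \<le> length \<rho>" "l = Suc d" using assms by (auto simp: d_def)
  define sh where "sh y = (if m \<le> y then y + 1 else y)" for y
  define emb where "emb i = (if i < d then i else Suc i)" for i
  define v where "v = insert_cell \<rho> (m, l)"
  have v: "v = take d (map sh \<rho>) @ m # drop d (map sh \<rho>)"
    by (simp add: v_def insert_cell_def d_def sh_def[abs_def] Let_def)
  have lenv: "length v = Suc (length \<rho>)" using d by (simp add: v)
  have vd: "v ! d = m" using d by (simp add: v nth_append)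
  have ve: "v ! emb i = sh (\<rho> ! i)" if "i < length \<rho>" for i
    using that d by (auto simp: v emb_def nth_append)
  have emb_ex: "\<exists>i < length \<rho>. j = emb i" if "j < length v" "j \<noteq> d" for j
  proof (cases "j < d")
    case True then show ?thesis using d by (intro exI[of _ j]) (auto simp: emb_def)
  next
    case False then show ?thesis using that lenv by (intro exI[of _ "j - 1"]) (auto simp: emb_def)
  qed
  have emb_lt: "emb i < Suc (length \<rho>)" if "i < length \<rho>" for i using that by (auto simp: emb_def)
  have ob: "obstructed (pts \<rho>) (m, l) \<longleftrightarrow> (\<exists>i < length \<rho>. \<exists>j < length \<rho>. i < j \<and>
     (d \<le> i \<and> m \<le> \<rho> ! j \<and> \<rho> ! j < \<rho> ! i \<or>
      i < d \<and> d \<le> j \<and> \<rho> ! i < \<rho> ! j \<and> \<rho> ! j < m \<or>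
      j < d \<and> \<rho> ! i < m \<and> m \<le> \<rho> ! j))"
    unfolding obstructed_def split bex_pts d(2) by simp
  have cmp: "emb i < emb j \<longleftrightarrow> i < j" "sh y < sh z \<longleftrightarrow> y < z" "emb i < d \<longleftrightarrow> i < d"
    "d < emb i \<longleftrightarrow> d \<le> i" "sh y < m \<longleftrightarrow> y < m" "m < sh y \<longleftrightarrow> m \<le> y" for i j y z
    by (auto simp: emb_def sh_def)
  show ?thesis
  proof
    assume "infeasible \<rho> (m, l)"
    then obtain i j k where o: "(i, j, k) \<in> occs132 v" and "d \<in> {i, j, k}"
      by (auto simp: infeasible_def v_def d_def)
    then have lt: "i < j" "j < k" "k < length v" "v ! i < v ! k" "v ! k < v ! j"
      by (auto simp: occs132_def)
    consider "i = d" | "j = d" | "k = d" using \<open>d \<in> {i, j, k}\<close> by auto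
    then show "obstructed (pts \<rho>) (m, l)"
    proof cases
      case 1
      then obtain j' k' where "j' < length \<rho>" "j = emb j'" "k' < length \<rho>" "k = emb k'"
        using emb_ex[of j] emb_ex[of k] lt by auto
      then show ?thesis unfolding ob using lt 1 vd
        by (intro exI[of _ j'] exI[of _ k'] conjI) (auto simp: ve cmp)
    next
      case 2
      then obtain i' k' where "i' < length \<rho>" "i = emb i'" "k' < length \<rho>" "k = emb k'"
        using emb_ex[of i] emb_ex[of k] lt by auto
      then show ?thesis unfolding ob using lt 2 vd
        by (intro exI[of _ i'] exI[of _ k'] conjI) (auto simp: ve cmp)
    next
      case 3
      then obtain i' j' where "i' < length \<rho>" "i = emb i'" "j' < length \<rho>" "j = emb j'"
        using emb_ex[of i] emb_ex[of j] lt by auto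
      then show ?thesis unfolding ob using lt 3 vd
        by (intro exI[of _ i'] exI[of _ j'] conjI) (auto simp: ve cmp)
    qed
  next
    assume "obstructed (pts \<rho>) (m, l)"
    then obtain i j where ij: "i < j" "j < length \<rho>" "i < length \<rho>" and
      c: "d \<le> i \<and> m \<le> \<rho> ! j \<and> \<rho> ! j < \<rho> ! i \<or>
          i < d \<and> d \<le> j \<and> \<rho> ! i < \<rho> ! j \<and> \<rho> ! j < m \<or>
          j < d \<and> \<rho> ! i < m \<and> m \<le> \<rho> ! j"
      unfolding ob by auto
    note e = emb_lt[OF ij(2)] emb_lt[OF ij(3)] ve[OF ij(2)] ve[OF ij(3)] d le_imp_less_Suc[OF d(1)] lenv vd cmp
    have "(d, emb i, emb j) \<in> occs132 v \<or> (emb i, d, emb j) \<in> occs132 v \<or> (emb i, emb j, d) \<in> occs132 v"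
      using c ij(1) by (auto simp: occs132_def e)
    then show "infeasible \<rho> (m, l)" by (auto simp: infeasible_def v_def d_def)
  qed
qed

lemma in_feasible_cells_iff:
  "(m, l) \<in> feasible_cells \<rho> \<longleftrightarrow>
     1 \<le> m \<and> m \<le> length \<rho> \<and> 1 \<le> l \<and> l \<le> Suc (length \<rho>) \<and> \<not> obstructed (pts \<rho>) (m, l)"
  using infeasible_iff[of l \<rho> m] by (auto simp: feasible_cells_def)

lemma finite_feasible_cells: "finite (feasible_cells \<rho>)"
  by (rule finite_subset[of _ "{1..length \<rho>} \<times> {1..length \<rho> + 1}"]) (auto simp: feasible_cells_def)

lemma perm_words_value_ex:
  assumes "\<rho> \<in> perm_words" "1 \<le> m" "m \<le> length \<rho>"
  obtains p where "p \<in> pts \<rho>" "snd p = m"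
proof -
  have "m \<in> set \<rho>" using assms by (auto simp: perm_words_def)
  then obtain i where "i < length \<rho>" "\<rho> ! i = m" by (auto simp: in_set_conv_nth)
  then have "(i, m) \<in> pts \<rho>" by (auto simp: pts_def)
  then show ?thesis using that by auto
qed

text \<open>The entries of \<open>\<rho>\<close> below and to the left of a feasible cell would form a union of
  components avoiding the maximal entry.\<close>

lemma feasible_no_left_below:
  assumes \<rho>: "\<rho> \<in> perm_words" "conn (pts \<rho>)" and c: "(m, l) \<in> feasible_cells \<rho>"
    and k: "k \<in> pts \<rho>" "Suc (fst k) < l"
  shows "m \<le> snd k"
proof -
  have m: "1 \<le> m" "m \<le> length \<rho>" and ob: "\<not> obstructed (pts \<rho>) (m, l)"
    using c by (auto simp: in_feasible_cells_iff)
  have no: "\<not> (l \<le> Suc (fst p) \<and> m \<le> snd q \<and> snd q < snd p)"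
    "\<not> (Suc (fst p) < l \<and> l \<le> Suc (fst q) \<and> snd p < snd q \<and> snd q < m)"
    "\<not> (Suc (fst q) < l \<and> snd p < m \<and> m \<le> snd q)"
    if "p \<in> pts \<rho>" "q \<in> pts \<rho>" "fst p < fst q" for p q
    using ob that unfolding obstructed_def split by blast+
  let ?P = "{k \<in> pts \<rho>. Suc (fst k) < l \<and> snd k < m}"
  have "closed_in (pts \<rho>) (pts \<rho> - ?P)"
  proof (rule closed_inI, goal_cases)
    case (2 p q r)
    have pqr: "p \<in> pts \<rho>" "q \<in> pts \<rho>" "r \<in> pts \<rho>" "fst p < fst q" "fst q < fst r"
      "snd p < snd r" "snd r < snd q" using 2(1) by (auto simp: occs_def)
    have pr: "fst p < fst r" using pqr by simp
    \<comment> \<open>An entry inserted into the cell must not complete a 132. As first entry before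
      \<open>q\<close> and \<open>r\<close>, or as middle entry between \<open>p\<close> and
      \<open>r\<close>, it forces \<open>q\<close> to the left; as last entry after \<open>p\<close>
      and \<open>q\<close> it forces \<open>q\<close> below; as middle entry between
      \<open>p\<close> and \<open>r\<close> it then forces \<open>r\<close> to the left.\<close>
    have "p \<in> ?P \<and> q \<in> ?P \<and> r \<in> ?P" if "p \<in> ?P"
    proof -
      have p: "Suc (fst p) < l" "snd p < m" using that by auto
      have q: "Suc (fst q) < l"
        using no(1)[OF pqr(2,3,5)] no(2)[OF pqr(1,3) pr] pqr(5-7) p by (cases "snd r < m") auto
      have "snd q < m" using no(3)[OF pqr(1,2,4)] q p by simp
      moreover from this have "Suc (fst r) < l" using no(2)[OF pqr(1,3) pr] pqr(5-7) p by simp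
      ultimately show ?thesis using that pqr q by simp
    qed
    \<comment> \<open>The first entry of an occurrence is left of and below the other two.\<close>
    moreover have "p \<in> ?P" if "q \<in> ?P \<or> r \<in> ?P" using that pqr by auto
    ultimately show ?case using 2(2) pqr(1-3) by blast
  qed auto
  \<comment> \<open>There are no cells above the maximal entry: \<open>m\<close> is a value of
    \<rho>, so the maximum is at least \<open>m\<close> and lies outside \<open>?P\<close>.\<close>
  moreover have "top_pts (pts \<rho>) \<subseteq> pts \<rho> - ?P"
  proof
    fix t assume t: "t \<in> top_pts (pts \<rho>)"
    obtain q where "q \<in> pts \<rho>" "snd q = m" using perm_words_value_ex[OF \<rho>(1) m] .
    then show "t \<in> pts \<rho> - ?P" using t by (auto simp: top_pts_def)
  qed
  ultimately have "pts \<rho> - ?P = pts \<rho>" using conn_closed_eq[OF \<rho>(2)] by blast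
  then show ?thesis using k by fastforce
qed

text \<open>Suppose that \<open>(m', l')\<close> is strictly right of and above
  \<open>(m, l)\<close>. Between the two columns there is an entry \<open>?d\<close>, and between
  the two rows an entry \<open>e\<close>. Nothing is below-left of \<open>(m', l')\<close>, so
  \<open>?d\<close> lies above it and \<open>e\<close> to its right. An element inserted into
  \<open>(m, l)\<close> would then be the first entry of a 132 with \<open>?d\<close> and
  \<open>e\<close>.\<close>

lemma feasible_cells_linear:
  assumes \<rho>: "\<rho> \<in> perm_words" "conn (pts \<rho>)"
    and c: "(m, l) \<in> feasible_cells \<rho>" and c': "(m', l') \<in> feasible_cells \<rho>"
  shows "\<not> (m < m' \<and> l < l')"
proof
  assume lt: "m < m' \<and> l < l'"
  have b: "1 \<le> m" "m \<le> length \<rho>" "1 \<le> l" "l' \<le> Suc (length \<rho>)" and ob: "\<not> obstructed (pts \<rho>) (m, l)"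
    using c c' by (auto simp: in_feasible_cells_iff)
  \<comment> \<open>The \<open>l\<close>-th entry in the 1-based count of cells. It exists because
    \<open>l < l'\<close> and \<open>l'\<close> is at most one more than the size.\<close>
  let ?d = "(l - 1, \<rho> ! (l - 1))"
  have d: "?d \<in> pts \<rho>" using b lt by (auto simp: pts_def)
  have "m' \<le> snd ?d" using feasible_no_left_below[OF \<rho> c' d] b lt by simp
  obtain e where e: "e \<in> pts \<rho>" "snd e = m" using perm_words_value_ex[OF \<rho>(1) b(1,2)] .
  have "l' \<le> Suc (fst e)" using feasible_no_left_below[OF \<rho> c' e(1)] e lt by force
  have "obstructed (pts \<rho>) (m, l)"
    unfolding obstructed_def split
    using d e \<open>m' \<le> snd ?d\<close> \<open>l' \<le> Suc (fst e)\<close> lt b(3)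
    by (intro bexI[of _ ?d] bexI[of _ e]) auto
  with ob show False ..
qed

lemma feasible_cells_total:
  assumes "\<rho> \<in> perm_words" "conn (pts \<rho>)" "c \<in> feasible_cells \<rho>" "c' \<in> feasible_cells \<rho>" "c \<noteq> c'"
  shows "cell_prec c c' \<or> cell_prec c' c"
  using assms(3-5) feasible_cells_linear[OF assms(1,2), of "fst c" "snd c" "fst c'" "snd c'"]
    feasible_cells_linear[OF assms(1,2), of "fst c'" "snd c'" "fst c" "snd c"]
  by (cases c; cases c') (auto simp: cell_prec_def)

lemma
  assumes \<rho>: "\<rho> \<in> perm_words" "conn (pts \<rho>)"
  shows set_cell_list: "set (cell_list \<rho>) = feasible_cells \<rho>"
    and sorted_cell_list: "sorted_wrt cell_prec (cell_list \<rho>)"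
proof -
  \<comment> \<open>Along \<open>cell_prec\<close> the row weakly falls, the column weakly rises,
    and one of them changes, so column minus row strictly increases. Sorting by this integer gives
    the list, and a strictly sorted list is determined by its set.\<close>
  define key :: "nat \<times> nat \<Rightarrow> int" where "key = (\<lambda>(m, l). int l - int m)"
  let ?F = "feasible_cells \<rho>"
  have key: "key c < key c'" if "cell_prec c c'" for c c'
    using that by (cases c; cases c') (auto simp: key_def cell_prec_def)
  have less: "cell_prec c c' \<longleftrightarrow> key c < key c'" if "c \<in> ?F" "c' \<in> ?F" for c c'
    using key[of c c'] key[of c' c] feasible_cells_total[OF \<rho> that] by fastforce
  have inj: "inj_on key ?F"
    using less feasible_cells_total[OF \<rho>] by (metis inj_onI less_irrefl)
  define cs where "cs = map (inv_into ?F key) (sorted_list_of_set (key ` ?F))"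
  have fin: "finite (key ` ?F)" using finite_feasible_cells by blast
  have "set cs = ?F" unfolding cs_def using fin inj by (simp add: inv_into_image_cancel image_comp)
  moreover have "sorted_wrt cell_prec cs"
  proof -
    have "sorted_wrt (<) (sorted_list_of_set (key ` ?F))" by simp
    moreover have "cell_prec (inv_into ?F key x) (inv_into ?F key y)"
      if "x \<in> key ` ?F" "y \<in> key ` ?F" "x < y" for x y
      using that less[OF inv_into_into[OF that(1)] inv_into_into[OF that(2)]] by (simp add: f_inv_into_f)
    ultimately show ?thesis unfolding cs_def sorted_wrt_map
      by (rule sorted_wrt_mono_rel[rotated]) (use fin in auto)
  qed
  moreover have "xs = ys"
    if "set xs = ?F" "sorted_wrt cell_prec xs" "set ys = ?F" "sorted_wrt cell_prec ys" for xs ys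
  proof -
    have "sorted_wrt (<) (map key zs)" if "sorted_wrt cell_prec zs" for zs
      unfolding sorted_wrt_map using sorted_wrt_mono_rel[OF _ that, of "\<lambda>x y. key x < key y"] key by blast
    then have "map key xs = map key ys"
      using that strict_sorted_equal by (metis set_map)
    then show ?thesis using inj that by (metis inj_on_map_eq_map Un_absorb)
  qed
  ultimately have "\<exists>!cs. set cs = ?F \<and> sorted_wrt cell_prec cs" by blast
  from theI'[OF this] show "set (cell_list \<rho>) = ?F" "sorted_wrt cell_prec (cell_list \<rho>)"
    unfolding cell_list_def by auto
qed

lemma distinct_cell_list:
  assumes "\<rho> \<in> perm_words" "conn (pts \<rho>)" shows "distinct (cell_list \<rho>)"
proof -
  have "cell_list \<rho> ! i \<noteq> cell_list \<rho> ! j" if "i < j" "j < length (cell_list \<rho>)" for i j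
    using sorted_wrt_nth_less[OF sorted_cell_list[OF assms] that] by (auto simp: cell_prec_def)
  then show ?thesis unfolding distinct_conv_nth by (metis nat_neq_iff)
qed

lemma length_cell_list:
  assumes "\<rho> \<in> perm_words" "conn (pts \<rho>)" shows "length (cell_list \<rho>) = num_feasible \<rho>"
  using distinct_card[OF distinct_cell_list[OF assms]] by (simp add: num_feasible_def set_cell_list[OF assms])

section \<open>The cells of the non-kernel points\<close>

lemma cell_of_left:
  "finite K \<Longrightarrow> k \<in> K \<Longrightarrow> Suc (fst (norm_pt K k)) < snd (cell_of K p) \<longleftrightarrow> fst k < fst p"
  by (simp add: norm_pt_def cell_of_def xrank_less_iff)

lemma cell_of_below:
  "finite K \<Longrightarrow> k \<in> K \<Longrightarrow> snd (norm_pt K k) < fst (cell_of K p) \<longleftrightarrow> snd k < snd p"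
  by (simp add: norm_pt_def cell_of_def yrank_less_iff)

text \<open>The cell of \<open>p\<close> records exactly which kernel points are left of
  \<open>p\<close> and which are below. An obstruction in the standardized kernel is therefore an
  occurrence through \<open>p\<close> itself; since no coordinate is shared, weak inequalities
  become strict.\<close>

lemma obstructed_cell_of:
  assumes K: "generic K" and p: "\<forall>k \<in> K. fst k \<noteq> fst p \<and> snd k \<noteq> snd p"
    and ob: "obstructed (pts (word_of K)) (cell_of K p)"
  shows "\<exists>a \<in> K. \<exists>b \<in> K. (p, a, b) \<in> occs (insert p K) \<or> (a, p, b) \<in> occs (insert p K) \<or>
    (a, b, p) \<in> occs (insert p K)"
proof -
  have fin: "finite K" using K by (rule generic_finite)
  obtain a b where ab: "a \<in> K" "b \<in> K" and
    o: "fst (norm_pt K a) < fst (norm_pt K b) \<and>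
     (\<not> Suc (fst (norm_pt K a)) < snd (cell_of K p) \<and> \<not> snd (norm_pt K b) < fst (cell_of K p) \<and>
        snd (norm_pt K b) < snd (norm_pt K a) \<or>
      Suc (fst (norm_pt K a)) < snd (cell_of K p) \<and> \<not> Suc (fst (norm_pt K b)) < snd (cell_of K p) \<and>
        snd (norm_pt K a) < snd (norm_pt K b) \<and> snd (norm_pt K b) < fst (cell_of K p) \<or>
      Suc (fst (norm_pt K b)) < snd (cell_of K p) \<and> snd (norm_pt K a) < fst (cell_of K p) \<and>
        \<not> snd (norm_pt K b) < fst (cell_of K p))"
    using ob unfolding pts_word_of[OF K] obstructed_def case_prod_beta not_less by blast
  have "fst a < fst b \<and>
     (\<not> fst a < fst p \<and> \<not> snd b < snd p \<and> snd b < snd a \<or>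
      fst a < fst p \<and> \<not> fst b < fst p \<and> snd a < snd b \<and> snd b < snd p \<or>
      fst b < fst p \<and> snd a < snd p \<and> \<not> snd b < snd p)"
    using o unfolding cell_of_left[OF fin ab(1)] cell_of_left[OF fin ab(2)] cell_of_below[OF fin ab(1)]
      cell_of_below[OF fin ab(2)] fst_norm_pt_less[OF K ab(1)] snd_norm_pt_less[OF K ab(1)]
      snd_norm_pt_less[OF K ab(2)] .
  moreover have "fst a \<noteq> fst p" "snd a \<noteq> snd p" "fst b \<noteq> fst p" "snd b \<noteq> snd p"
    using p ab by auto
  ultimately have "(p, a, b) \<in> occs (insert p K) \<or> (a, p, b) \<in> occs (insert p K) \<or>
    (a, b, p) \<in> occs (insert p K)" using ab unfolding occs_def by auto
  then show ?thesis using ab by blast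
qed

text \<open>An obstruction would put \<open>p\<close> into an occurrence with kernel points, and the
  kernel is closed.\<close>

lemma nonkernel_feasible:
  assumes A: "generic A" and p: "p \<in> A" "p \<notin> kset A"
  shows "cell_of (kset A) p \<in> feasible_cells (word_of (kset A))"
proof -
  let ?K = "kset A"
  have K: "generic ?K" using generic_subset[OF A kset_subset] .
  have fin: "finite ?K" using generic_finite[OF K] .
  have neq: "\<forall>k \<in> ?K. fst k \<noteq> fst p \<and> snd k \<noteq> snd p"
    using p generic_fst_eq[OF A _ p(1)] generic_snd_eq[OF A _ p(1)] kset_subset by blast
  have "\<not> obstructed (pts (word_of ?K)) (cell_of ?K p)"
  proof
    assume "obstructed (pts (word_of ?K)) (cell_of ?K p)"
    from obstructed_cell_of[OF K neq this] obtain a b where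
      ab: "a \<in> ?K" "b \<in> ?K" and o: "(p, a, b) \<in> occs (insert p ?K) \<or> (a, p, b) \<in> occs (insert p ?K) \<or>
      (a, b, p) \<in> occs (insert p ?K)" by blast
    have "insert p ?K \<subseteq> A" using p kset_subset by auto
    from o have "(p, a, b) \<in> occs A \<or> (a, p, b) \<in> occs A \<or> (a, b, p) \<in> occs A"
      unfolding occs_subset_iff[OF \<open>insert p ?K \<subseteq> A\<close>] by auto
    then show False using closed_inD[OF closed_in_kset] ab p(2) by blast
  qed
  \<comment> \<open>The maximal point is in the kernel and not below \<open>p\<close>, so the row of
    \<open>p\<close> is at most the size of the kernel.\<close>
  moreover have "yrank ?K p < card ?K"
  proof -
    have "A \<noteq> {}" using p(1) by auto
    then obtain t where t: "t \<in> top_pts A" using top_pts_nonempty[OF generic_finite[OF A]] by auto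
    then have "t \<in> ?K" using top_pts_subset_kset[of A] by auto
    moreover have "snd p \<le> snd t" using t p by (auto simp: top_pts_def)
    ultimately have "t \<in> ?K - {k \<in> ?K. snd k < snd p}" by simp
    then have "{k \<in> ?K. snd k < snd p} \<subset> ?K" by blast
    then show ?thesis unfolding yrank_def using fin by (rule psubset_card_mono[rotated])
  qed
  moreover have "xrank ?K p \<le> card ?K" unfolding xrank_def by (rule card_mono[OF fin]) auto
  ultimately show ?thesis by (simp add: cell_of_def in_feasible_cells_iff)
qed

lemma kset_word:
  assumes "generic A"
  shows "word_of (kset A) \<in> perm_words" "conn (pts (word_of (kset A)))"
  using word_of_perm_words generic_subset[OF assms kset_subset] conn_word_of_iff conn_kset by auto

lemma nonkernel_no_left_below:
  assumes A: "generic A" and p: "p \<in> A" "p \<notin> kset A" and k: "k \<in> kset A" "fst k < fst p"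
  shows "snd p < snd k"
proof -
  let ?K = "kset A"
  have K: "generic ?K" using generic_subset[OF A kset_subset] .
  have fin: "finite ?K" using generic_finite[OF K] .
  have "norm_pt ?K k \<in> pts (word_of ?K)" using k pts_word_of[OF K] by auto
  moreover have "(fst (cell_of ?K p), snd (cell_of ?K p)) \<in> feasible_cells (word_of ?K)"
    using nonkernel_feasible[OF A p] by simp
  ultimately have "fst (cell_of ?K p) \<le> snd (norm_pt ?K k)"
    using feasible_no_left_below[OF kset_word[OF A]] k cell_of_left[OF fin k(1)] by blast
  then have "\<not> snd k < snd p" using cell_of_below[OF fin k(1), of p] by simp
  moreover have "snd k \<noteq> snd p" using generic_snd_eq[OF A _ p(1)] k(1) p(2) kset_subset by blast
  ultimately show ?thesis by simp
qed

lemma xrank_le: "finite A \<Longrightarrow> fst p \<le> fst q \<Longrightarrow> xrank A p \<le> xrank A q"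
  unfolding xrank_def by (rule card_mono) auto

lemma yrank_le: "finite A \<Longrightarrow> snd p \<le> snd q \<Longrightarrow> yrank A p \<le> yrank A q"
  unfolding yrank_def by (rule card_mono) auto

text \<open>If the columns differ, some kernel point \<open>k\<close> stands horizontally between
  \<open>p\<close> and \<open>q\<close>. It is left of \<open>q\<close>, hence above
  \<open>q\<close>, and \<open>p\<close> below \<open>q\<close> would make \<open>p\<close>,
  \<open>k\<close>, \<open>q\<close> a 132. If the rows differ, some \<open>k\<close> lies
  vertically between \<open>q\<close> and \<open>p\<close>. It is below \<open>p\<close>, hence
  right of \<open>p\<close>, and \<open>q\<close> left of \<open>p\<close> would make
  \<open>q\<close>, \<open>p\<close>, \<open>k\<close> a 132. Either way a non-kernel point would
  share an occurrence with the kernel.\<close>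

lemma nonkernel_cells_decreasing:
  assumes A: "generic A" and p: "p \<in> A" "p \<notin> kset A" and q: "q \<in> A" "q \<notin> kset A"
    and prec: "cell_prec (cell_of (kset A) p) (cell_of (kset A) q)"
  shows "fst p < fst q \<and> snd q < snd p"
proof -
  let ?K = "kset A"
  have fin: "finite ?K" using generic_finite[OF generic_subset[OF A kset_subset]] .
  have le: "yrank ?K q \<le> yrank ?K p" "xrank ?K p \<le> xrank ?K q" and
    lt: "yrank ?K q < yrank ?K p \<or> xrank ?K p < xrank ?K q"
    using prec by (auto simp: cell_prec_def cell_of_def)
  have kA: "k \<in> A" if "k \<in> ?K" for k using that kset_subset by blast
  have neq: "fst k \<noteq> fst p" "snd k \<noteq> snd p" "fst k \<noteq> fst q" "snd k \<noteq> snd q" if "k \<in> ?K" for k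
    using generic_fst_eq[OF A kA[OF that]] generic_snd_eq[OF A kA[OF that]] that p q by auto
  have "p \<noteq> q" using lt by auto
  then have pq: "fst p \<noteq> fst q" "snd p \<noteq> snd q"
    using generic_fst_eq[OF A] generic_snd_eq[OF A] p q by auto
  have x: "fst p < fst q" if "xrank ?K p < xrank ?K q"
    using that xrank_le[OF fin, of q p] by linarith
  have y: "snd q < snd p" if "yrank ?K q < yrank ?K p"
    using that yrank_le[OF fin, of p q] by linarith
  have x': "snd q < snd p" if l: "xrank ?K p < xrank ?K q"
  proof (rule ccontr)
    assume "\<not> snd q < snd p"
    then have pq': "snd p < snd q" using pq by simp
    have "\<exists>k \<in> ?K. fst p \<le> fst k \<and> fst k < fst q"
    proof (rule ccontr)
      assume "\<not> ?thesis"
      then have "xrank ?K q \<le> xrank ?K p" unfolding xrank_def using fin by (intro card_mono) auto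
      with l show False by simp
    qed
    then obtain k where k: "k \<in> ?K" "fst p \<le> fst k" "fst k < fst q" by blast
    then have "snd q < snd k" using nonkernel_no_left_below[OF A q] by simp
    then have "(p, k, q) \<in> occs A" using k pq' p q neq(1)[OF k(1)] kA by (simp add: occs_def)
    then show False using closed_inD[OF closed_in_kset] k(1) p(2) by blast
  qed
  have y': "fst p < fst q" if l: "yrank ?K q < yrank ?K p"
  proof (rule ccontr)
    assume "\<not> fst p < fst q"
    then have pq': "fst q < fst p" using pq by simp
    have "\<exists>k \<in> ?K. snd q \<le> snd k \<and> snd k < snd p"
    proof (rule ccontr)
      assume "\<not> ?thesis"
      then have "yrank ?K p \<le> yrank ?K q" unfolding yrank_def using fin by (intro card_mono) auto
      with l show False by simp
    qed
    then obtain k where k: "k \<in> ?K" "snd q \<le> snd k" "snd k < snd p" by blast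
    then have "fst p < fst k"
      using nonkernel_no_left_below[OF A p k(1)] neq(1)[OF k(1)] by force
    then have "(q, p, k) \<in> occs A" using k pq' p q neq(4)[OF k(1)] kA by (simp add: occs_def)
    then show False using closed_inD[OF closed_in_kset] k(1) p(2) by blast
  qed
  show ?thesis using lt x y x' y' by blast
qed

section \<open>Decomposition along the kernel\<close>

lemma card_eq_sum_ind: "finite A \<Longrightarrow> card {q \<in> A. P q} = (\<Sum>q \<in> A. if P q then 1 else 0)"
  by (simp only: card_eq_sum sum.inter_filter)

lemma sum_if_less_delta:
  fixes a :: "nat \<Rightarrow> nat"
  assumes "j < f"
  shows "(\<Sum>i < f. if i = j then b else if i < j then a i else 0) = (\<Sum>i < j. a i) + b"
proof -
  have "{..<f} = insert j ({..<j} \<union> {Suc j..<f})" using assms by auto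
  moreover have "(\<Sum>i \<in> {..<j} \<union> {Suc j..<f}. if i = j then b else if i < j then a i else 0)
      = (\<Sum>i < j. a i)"
    by (subst sum.union_disjoint) (auto intro!: sum.neutral)
  ultimately show ?thesis by simp
qed

lemma occs_mono: "B \<subseteq> A \<Longrightarrow> occs B \<subseteq> occs A"
  unfolding occs_def by auto

lemma occs_disjoint: "A \<inter> B = {} \<Longrightarrow> occs A \<inter> occs B = {}"
  unfolding occs_def by auto

text \<open>A double sum is additive in both arguments over disjoint parts. The left point comes
  from the first argument, so two distinct parts contribute in both orders.\<close>

definition invs_between :: "(nat \<times> nat) set \<Rightarrow> (nat \<times> nat) set \<Rightarrow> nat" where
  "invs_between A B = (\<Sum>p \<in> A. \<Sum>q \<in> B. if fst p < fst q \<and> snd q < snd p then 1 else 0)"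

lemma invs_between_self:
  assumes "finite A" shows "invs_between A A = card (invs A)"
proof -
  have "invs A = (SIGMA p:A. {q \<in> A. fst p < fst q \<and> snd q < snd p})" by (auto simp: invs_def)
  then show ?thesis using assms by (simp add: invs_between_def card_eq_sum_ind)
qed

lemma lcount_eq:
  assumes "cell_list \<rho> ! j = (m, l)"
  shows "lcount \<rho> j = card {p \<in> pts \<rho>. (Suc (fst p) < l \<and> \<not> snd p < m) \<or> (snd p < m \<and> \<not> Suc (fst p) < l)}"
proof -
  let ?L = "{k \<in> {1..length \<rho>}. (\<not> \<rho> ! (k - 1) < m \<and> k < l) \<or> (\<rho> ! (k - 1) < m \<and> \<not> k < l)}"
  let ?R = "{p \<in> pts \<rho>. (Suc (fst p) < l \<and> \<not> snd p < m) \<or> (snd p < m \<and> \<not> Suc (fst p) < l)}"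
  have "bij_betw (\<lambda>k. (k - 1, \<rho> ! (k - 1))) ?L ?R"
    by (rule bij_betw_byWitness[where f' = "\<lambda>p. Suc (fst p)"]) (auto simp: pts_def)
  then show ?thesis using bij_betw_same_card assms by (auto simp: lcount_def)
qed

definition block :: "(nat \<times> nat) set \<Rightarrow> (nat \<times> nat) set \<Rightarrow> nat \<times> nat \<Rightarrow> (nat \<times> nat) set" where
  "block A K c = {p \<in> A - K. cell_of K p = c}"

text \<open>The rank of a point is its rank in the kernel or in its own cell plus the number of points of
  the other parts that are left of it (below it).\<close>

definition rebuild :: "nat list \<Rightarrow> (nat \<times> nat \<Rightarrow> nat list) \<Rightarrow> (nat \<times> nat) set" where
  "rebuild \<rho> \<pi> =
     (\<lambda>(i, y). (i + (\<Sum>c \<in> feasible_cells \<rho>. if snd c \<le> Suc i then length (\<pi> c) else 0),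
                y + (\<Sum>c \<in> feasible_cells \<rho>. if fst c \<le> y then length (\<pi> c) else 0))) ` pts \<rho> \<union>
     (\<Union>c \<in> feasible_cells \<rho>. (\<lambda>(i, y).
        (snd c - 1 + (\<Sum>d \<in> feasible_cells \<rho>. if d = c then i else if cell_prec d c then length (\<pi> d) else 0),
         fst c + (\<Sum>d \<in> feasible_cells \<rho>. if d = c then y - 1 else if cell_prec c d then length (\<pi> d) else 0)))
        ` pts (\<pi> c))"

text \<open>The assumption \<open>K = kset A\<close> is deliberately absent. The locale holds for
  the kernel of a given point set and for an inflation built from prescribed words; in the latter
  case \<open>K\<close> is only known to be a copy of \<rho> until \<open>kset_eq\<close>.\<close>

locale layout =
  fixes \<rho> :: "nat list" and A K :: "(nat \<times> nat) set"
  assumes A: "generic A" and KA: "K \<subseteq> A"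
    and rho: "\<rho> \<in> perm_words" "conn (pts \<rho>)"
    and word_K: "word_of K = \<rho>"
    and feas: "p \<in> A - K \<Longrightarrow> cell_of K p \<in> feasible_cells \<rho>"
    and decr: "p \<in> A - K \<Longrightarrow> q \<in> A - K \<Longrightarrow> cell_prec (cell_of K p) (cell_of K q) \<Longrightarrow>
      fst p < fst q \<and> snd q < snd p"
begin

abbreviation "F \<equiv> feasible_cells \<rho>"
abbreviation "C \<equiv> block A K"

lemma K: "generic K" using generic_subset[OF A KA] .
lemma fin: "finite A" using generic_finite[OF A] .
lemma finK: "finite K" using generic_finite[OF K] .
lemma pts_rho: "pts \<rho> = norm_pt K ` K" using pts_word_of[OF K] word_K by simp
lemma card_K: "card K = length \<rho>" using word_K by auto
lemma C_subset: "C c \<subseteq> A" by (auto simp: block_def)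
lemma generic_C: "generic (C c)" using generic_subset[OF A C_subset] .
lemma finC: "finite (C c)" using generic_finite[OF generic_C] .
lemma C_disjoint: "c \<noteq> d \<Longrightarrow> C c \<inter> C d = {}" unfolding block_def by blast
lemma K_C_disjoint: "K \<inter> C c = {}" by (auto simp: block_def)
lemma C_empty:
  assumes "c \<notin> F" shows "C c = {}"
proof -
  have "p \<notin> C c" for p using feas[of p] assms by (auto simp: block_def)
  then show ?thesis by blast
qed

lemma A_split: "A = K \<union> (\<Union>c \<in> F. C c)"
proof (intro equalityI subsetI)
  fix p assume "p \<in> A"
  then have "p \<in> K \<or> p \<in> C (cell_of K p) \<and> cell_of K p \<in> F"
    using feas[of p] by (auto simp: block_def)
  then show "p \<in> K \<union> (\<Union>c \<in> F. C c)" by blast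
next
  fix p assume "p \<in> K \<union> (\<Union>c \<in> F. C c)"
  then show "p \<in> A" using KA C_subset by blast
qed

lemma conn_K: "conn K"
  using conn_word_of_iff[OF K] rho(2) word_K by simp

lemma sum_split: "sum g A = sum g K + (\<Sum>c \<in> F. sum g (C c))" for g :: "nat \<times> nat \<Rightarrow> nat"
proof -
  have "sum g A = sum g K + sum g (\<Union>c \<in> F. C c)"
    using K_C_disjoint finK finC finite_feasible_cells
    by (subst A_split, subst sum.union_disjoint) auto
  also have "sum g (\<Union>c \<in> F. C c) = (\<Sum>c \<in> F. sum g (C c))"
    using finite_feasible_cells finC C_disjoint by (subst sum.UNION_disjoint) auto
  finally show ?thesis .
qed

lemma card_split: "card {q \<in> A. P q} = card {q \<in> K. P q} + (\<Sum>c \<in> F. card {q \<in> C c. P q})"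
  using sum_split[of "\<lambda>q. if P q then 1 else 0"] by (simp add: card_eq_sum_ind fin finK finC)

lemma card_A: "card A = length \<rho> + (\<Sum>c \<in> F. card (C c))"
  using card_split[of "\<lambda>_. True"] by (simp add: card_K)

lemma neq: "p \<in> A \<Longrightarrow> q \<in> A \<Longrightarrow> p \<noteq> q \<Longrightarrow> fst p \<noteq> fst q \<and> snd p \<noteq> snd q"
  using generic_fst_eq[OF A] generic_snd_eq[OF A] by blast

lemma same_cell:
  assumes "p \<in> A - K" "q \<in> A - K" "fst p < fst q" "snd p < snd q"
  shows "cell_of K p = cell_of K q"
  using feasible_cells_total[OF rho feas[OF assms(1)] feas[OF assms(2)]]
    decr[OF assms(1,2)] decr[OF assms(2,1)] assms(3,4) by force

lemma no_left_below:
  assumes "k \<in> K" "p \<in> A - K" "fst k < fst p"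
  shows "\<not> snd k < snd p"
proof -
  have "norm_pt K k \<in> pts \<rho>" using assms pts_rho by auto
  moreover have "(fst (cell_of K p), snd (cell_of K p)) \<in> F" using feas[OF assms(2)] by simp
  ultimately have "fst (cell_of K p) \<le> snd (norm_pt K k)"
    using feasible_no_left_below[OF rho] assms cell_of_left[OF finK assms(1)] by blast
  then show ?thesis using cell_of_below[OF finK assms(1), of p] by simp
qed

text \<open>The first entry \<open>p\<close> decides. If \<open>p\<close> is in \<open>K\<close>,
  the other two entries are right of and above \<open>p\<close>, so they are in \<open>K\<close> as
  nothing of \<open>K\<close> is below-left of a cell. If \<open>p\<close> is not in
  \<open>K\<close> but both others are, they obstruct the cell of \<open>p\<close>. If exactly one
  other entry is in \<open>K\<close>, the remaining one shares the cell of \<open>p\<close> because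
  the two increase, yet the kernel entry separates them by height or by position. If no entry is in
  \<open>K\<close>, all three share one cell.\<close>

lemma occs_split_subset: "occs A \<subseteq> occs K \<union> (\<Union>c \<in> F. occs (C c))"
proof clarify
  fix p1 p2 q1 q2 r1 r2
  assume o: "((p1, p2), (q1, q2), (r1, r2)) \<in> occs A" and n: "((p1, p2), (q1, q2), (r1, r2)) \<notin> (\<Union>c \<in> F. occs (C c))"
  define p q r where "p = (p1, p2)" and "q = (q1, q2)" and "r = (r1, r2)"
  have pqr: "p \<in> A" "q \<in> A" "r \<in> A" "fst p < fst q" "fst q < fst r" "snd p < snd r" "snd r < snd q"
    using o by (auto simp: occs_def p_def q_def r_def)
  have "p \<in> K"
  proof (rule ccontr)
    assume "p \<notin> K"
    then have p: "p \<in> A - K" using pqr by simp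
    consider "q \<in> K" "r \<in> K" | "q \<in> A - K" "r \<in> K" | "q \<in> K" "r \<in> A - K" | "q \<in> A - K" "r \<in> A - K"
      using pqr by blast
    then show False
    proof cases
      case 1
      have "norm_pt K q \<in> pts \<rho>" "norm_pt K r \<in> pts \<rho>" using 1 pts_rho by auto
      moreover have "fst (norm_pt K q) < fst (norm_pt K r)" "snd (norm_pt K r) < snd (norm_pt K q)"
        using fst_norm_pt_less[OF K 1(1)] snd_norm_pt_less[OF K 1(2)] pqr by auto
      moreover have "snd (cell_of K p) \<le> Suc (fst (norm_pt K q))"
        using cell_of_left[OF finK 1(1), of p] pqr by linarith
      moreover have "fst (cell_of K p) \<le> snd (norm_pt K r)"
        using cell_of_below[OF finK 1(2), of p] pqr by linarith
      ultimately have "obstructed (pts \<rho>) (fst (cell_of K p), snd (cell_of K p))"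
        unfolding obstructed_def split by blast
      then show False using feas[OF p] by (cases "cell_of K p") (auto simp: in_feasible_cells_iff)
    next
      case 2
      then have "cell_of K p = cell_of K q" using same_cell[OF p 2(1)] pqr by simp
      then show False using cell_of_below[OF finK 2(2), of p] cell_of_below[OF finK 2(2), of q] pqr by simp
    next
      case 3
      then have "cell_of K p = cell_of K r" using same_cell[OF p 3(2)] pqr by simp
      then show False using cell_of_left[OF finK 3(1), of p] cell_of_left[OF finK 3(1), of r] pqr by simp
    next
      case 4
      have "cell_of K p = cell_of K q" "cell_of K p = cell_of K r"
        using same_cell[OF p 4(1)] same_cell[OF p 4(2)] pqr by simp_all
      then have "(p, q, r) \<in> occs (C (cell_of K p))" using pqr p 4 by (simp add: occs_def block_def)
      then show False using n feas[OF p] unfolding p_def q_def r_def by blast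
    qed
  qed
  moreover from this have "q \<in> K" "r \<in> K" using no_left_below[of p q] no_left_below[of p r] pqr by auto
  ultimately have "(p, q, r) \<in> occs K" using pqr by (simp add: occs_def)
  then show "((p1, p2), (q1, q2), (r1, r2)) \<in> occs K" by (simp add: p_def q_def r_def)
qed

lemma occs_split: "occs A = occs K \<union> (\<Union>c \<in> F. occs (C c))"
  using occs_split_subset occs_mono[OF KA] occs_mono[OF C_subset] by blast

text \<open>\<open>K\<close> is closed because occurrences do not cross the parts, and it contains
  the maximum because each cell lies below some point of \<open>K\<close>. This bounds
  \<open>kset A\<close> from above. Conversely \<open>kset A\<close> is closed within
  \<open>K\<close> and contains the common maximum, and \<open>K\<close> is connected.\<close>

lemma kset_eq: "kset A = K"
proof
  have "closed_in A K"
  proof (rule closed_inI[OF KA])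
    fix p q r assume "(p, q, r) \<in> occs A" "p \<in> K \<or> q \<in> K \<or> r \<in> K"
    then have "(p, q, r) \<in> occs K"
      unfolding occs_split by (auto simp: occs_def block_def)
    then show "p \<in> K \<and> q \<in> K \<and> r \<in> K" by (auto simp: occs_def)
  qed
  moreover have top: "top_pts A \<subseteq> K"
  proof
    fix t assume t: "t \<in> top_pts A"
    show "t \<in> K"
    proof (rule ccontr)
      assume "t \<notin> K"
      then have tA: "t \<in> A - K" using t top_pts_subset[of A] by auto
      obtain m l where c: "cell_of K t = (m, l)" by (cases "cell_of K t")
      then have "1 \<le> m" "m \<le> length \<rho>" using feas[OF tA] by (auto simp: in_feasible_cells_iff)
      then obtain p where "p \<in> pts \<rho>" "snd p = m" using perm_words_value_ex[OF rho(1)] by blast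
      then obtain k where k: "k \<in> K" "snd (norm_pt K k) = m" using pts_rho by auto
      then have "\<not> snd k < snd t" using cell_of_below[OF finK k(1), of t] c by simp
      moreover have "k \<in> A" "k \<noteq> t" using k KA \<open>t \<notin> K\<close> by auto
      ultimately show False using t neq[of k t] tA by (auto simp: top_pts_def)
    qed
  qed
  ultimately show "kset A \<subseteq> K" by (rule kset_least)
  then have "closed_in K (kset A)"
    using closed_in_kset[of A] occs_mono[OF KA] unfolding closed_in_def by blast
  moreover have "top_pts K \<subseteq> kset A"
  proof
    fix t assume t: "t \<in> top_pts K"
    then have "t \<in> A" using top_pts_subset[of K] KA by auto
    then have "A \<noteq> {}" by auto
    then obtain s where s: "s \<in> top_pts A" using top_pts_nonempty[OF fin] by auto
    then have "snd s \<le> snd t" using top t by (auto simp: top_pts_def)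
    then have "t \<in> top_pts A" using s \<open>t \<in> A\<close> by (force simp: top_pts_def)
    then show "t \<in> kset A" using top_pts_subset_kset by auto
  qed
  ultimately show "K \<subseteq> kset A" using conn_closed_eq[OF conn_K] by auto
qed

lemma num132_split: "num132 (word_of A) = num132 \<rho> + (\<Sum>c \<in> F. num132 (word_of (C c)))"
proof -
  have "card (occs A) = card (occs K) + card (\<Union>c \<in> F. occs (C c))"
    unfolding occs_split using finite_occs finK finC finite_feasible_cells occs_disjoint[OF K_C_disjoint]
    by (intro card_Un_disjoint) blast+
  also have "card (\<Union>c \<in> F. occs (C c)) = (\<Sum>c \<in> F. card (occs (C c)))"
    by (rule card_UN_disjoint) (simp_all add: finite_feasible_cells finite_occs finC occs_disjoint C_disjoint)
  finally show ?thesis using num132_word_of[OF K] num132_word_of[OF A] num132_word_of[OF generic_C]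
    by (simp add: word_K)
qed

lemma invs_between_split_left: "invs_between A B = invs_between K B + (\<Sum>c \<in> F. invs_between (C c) B)"
  unfolding invs_between_def by (rule sum_split)

lemma invs_between_split_right: "invs_between B A = invs_between B K + (\<Sum>c \<in> F. invs_between B (C c))"
proof -
  have "invs_between B A = (\<Sum>p \<in> B. (\<Sum>q \<in> K. if fst p < fst q \<and> snd q < snd p then 1 else 0) +
      (\<Sum>c \<in> F. \<Sum>q \<in> C c. if fst p < fst q \<and> snd q < snd p then 1 else 0))"
    unfolding invs_between_def by (simp only: sum_split)
  also have "\<dots> = invs_between B K + (\<Sum>c \<in> F. invs_between B (C c))"
    unfolding invs_between_def sum.distrib by (subst sum.swap) simp
  finally show ?thesis .
qed

text \<open>Whether a kernel point forms an inversion with a point of a cell depends only on its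
  side of the cell: it does so exactly when above-left or below-right. Each point of the block thus
  contributes \<open>lcount \<rho> j\<close>.\<close>

lemma invs_between_kernel_block:
  assumes j: "j < num_feasible \<rho>"
  shows "invs_between K (C (cell_list \<rho> ! j)) + invs_between (C (cell_list \<rho> ! j)) K =
    lcount \<rho> j * card (C (cell_list \<rho> ! j))"
proof -
  obtain m l where ml: "cell_list \<rho> ! j = (m, l)" by (cases "cell_list \<rho> ! j")
  have *: "(\<Sum>k \<in> K. (if fst k < fst q \<and> snd q < snd k then 1 else 0) +
      (if fst q < fst k \<and> snd k < snd q then 1 else 0)) = lcount \<rho> j" if q: "q \<in> C (m, l)" for q
  proof -
    have c: "cell_of K q = (m, l)" and qA: "q \<in> A - K" using q by (auto simp: block_def)
    have "(\<Sum>k \<in> K. (if fst k < fst q \<and> snd q < snd k then 1 else 0) +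
      (if fst q < fst k \<and> snd k < snd q then 1 else 0)) =
      (\<Sum>k \<in> K. if (fst k < fst q \<and> \<not> snd k < snd q) \<or> (snd k < snd q \<and> \<not> fst k < fst q) then 1 else 0::nat)"
    proof (rule sum.cong)
      fix k assume "k \<in> K"
      then have "fst k \<noteq> fst q \<and> snd k \<noteq> snd q" using neq[of k q] KA qA by auto
      then show "(if fst k < fst q \<and> snd q < snd k then 1 else 0) +
        (if fst q < fst k \<and> snd k < snd q then 1 else 0) =
        (if (fst k < fst q \<and> \<not> snd k < snd q) \<or> (snd k < snd q \<and> \<not> fst k < fst q) then 1 else 0::nat)"
        by auto
    qed simp
    also have "\<dots> = card {k \<in> K. (fst k < fst q \<and> \<not> snd k < snd q) \<or> (snd k < snd q \<and> \<not> fst k < fst q)}"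
      by (rule card_eq_sum_ind[OF finK, symmetric])
    also have "\<dots> = card (norm_pt K ` {k \<in> K. (fst k < fst q \<and> \<not> snd k < snd q) \<or> (snd k < snd q \<and> \<not> fst k < fst q)})"
      by (rule card_image[symmetric]) (rule inj_on_subset[OF inj_on_norm_pt[OF K]], auto)
    also have "norm_pt K ` {k \<in> K. (fst k < fst q \<and> \<not> snd k < snd q) \<or> (snd k < snd q \<and> \<not> fst k < fst q)} =
      {p \<in> norm_pt K ` K. (Suc (fst p) < l \<and> \<not> snd p < m) \<or> (snd p < m \<and> \<not> Suc (fst p) < l)}"
      using cell_of_left[OF finK, of _ q] cell_of_below[OF finK, of _ q] c by auto
    also have "card \<dots> = lcount \<rho> j" using lcount_eq[OF ml] pts_rho by simp
    finally show ?thesis .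
  qed
  have "invs_between K (C (m, l)) + invs_between (C (m, l)) K =
    (\<Sum>q \<in> C (m, l). \<Sum>k \<in> K. (if fst k < fst q \<and> snd q < snd k then 1 else 0) +
      (if fst q < fst k \<and> snd k < snd q then 1 else 0))"
    unfolding invs_between_def sum.distrib by (subst sum.swap) simp
  also have "\<dots> = (\<Sum>q \<in> C (m, l). lcount \<rho> j)" by (rule sum.cong) (simp_all only: *)
  finally show ?thesis by (simp add: ml)
qed

lemma sum_cells: "(\<Sum>c \<in> F. g c) = (\<Sum>j < num_feasible \<rho>. g (cell_list \<rho> ! j))"
  using sum.reindex_bij_betw[OF bij_betw_nth[OF distinct_cell_list[OF rho] refl refl], of g]
  unfolding length_cell_list[OF rho] set_cell_list[OF rho] by (rule sym)

text \<open>An earlier block is entirely left of and above a later one, so all pairs in that order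
  are inversions and none in the opposite order.\<close>

lemma invs_between_blocks:
  assumes "i < num_feasible \<rho>" "j < num_feasible \<rho>"
  shows "invs_between (C (cell_list \<rho> ! i)) (C (cell_list \<rho> ! j)) =
    (if i = j then card (invs (C (cell_list \<rho> ! j)))
     else if i < j then card (C (cell_list \<rho> ! i)) * card (C (cell_list \<rho> ! j)) else 0)"
proof -
  have prec: "cell_prec (cell_list \<rho> ! i) (cell_list \<rho> ! j)" if "i < j" "j < num_feasible \<rho>" for i j
    using sorted_wrt_nth_less[OF sorted_cell_list[OF rho] that(1)] that(2) length_cell_list[OF rho] by simp
  have d: "fst p < fst q \<and> snd q < snd p"
    if "p \<in> C c" "q \<in> C c'" "cell_prec c c'" for p q c c'
    using that decr[of p q] by (auto simp: block_def)
  consider "i = j" | "i < j" | "j < i" by linarith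
  then show ?thesis
  proof cases
    case 1 then show ?thesis using invs_between_self[OF finC] by simp
  next
    case 2
    have "invs_between (C (cell_list \<rho> ! i)) (C (cell_list \<rho> ! j)) =
      (\<Sum>p \<in> C (cell_list \<rho> ! i). \<Sum>q \<in> C (cell_list \<rho> ! j). 1)"
      unfolding invs_between_def using d[OF _ _ prec[OF 2 assms(2)]] by (intro sum.cong) auto
    then show ?thesis using 2 by simp
  next
    case 3
    have "invs_between (C (cell_list \<rho> ! i)) (C (cell_list \<rho> ! j)) = 0"
      unfolding invs_between_def using d[OF _ _ prec[OF 3 assms(1)]]
      by (intro sum.neutral ballI) (metis less_asym)
    then show ?thesis using 3 by simp
  qed
qed

lemma card_inversions_split:
  "card (inversions (word_of A)) = card (inversions \<rho>)
    + (\<Sum>j < num_feasible \<rho>. \<Sum>i < j. card (C (cell_list \<rho> ! i)) * card (C (cell_list \<rho> ! j)))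
    + (\<Sum>j < num_feasible \<rho>. lcount \<rho> j * card (C (cell_list \<rho> ! j)))
    + (\<Sum>j < num_feasible \<rho>. card (inversions (word_of (C (cell_list \<rho> ! j)))))"
proof -
  let ?f = "num_feasible \<rho>" and ?D = "\<lambda>j. C (cell_list \<rho> ! j)"
  have "invs_between A A = invs_between K K + (\<Sum>c \<in> F. invs_between K (C c) + invs_between (C c) K)
      + (\<Sum>c \<in> F. \<Sum>d \<in> F. invs_between (C c) (C d))"
    unfolding invs_between_split_left[of A] invs_between_split_right[of K]
      invs_between_split_right[of "C _"] by (simp add: sum.distrib)
  also have "(\<Sum>c \<in> F. invs_between K (C c) + invs_between (C c) K) = (\<Sum>j < ?f. lcount \<rho> j * card (?D j))"
    unfolding sum_cells using invs_between_kernel_block by simp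
  also have "(\<Sum>c \<in> F. \<Sum>d \<in> F. invs_between (C c) (C d)) = (\<Sum>i < ?f. \<Sum>j < ?f. invs_between (?D i) (?D j))"
    unfolding sum_cells ..
  also have "\<dots> = (\<Sum>j < ?f. \<Sum>i < ?f. if i = j then card (invs (?D j)) else if i < j then card (?D i) * card (?D j) else 0)"
    using invs_between_blocks by (subst sum.swap) (intro sum.cong; simp)
  also have "\<dots> = (\<Sum>j < ?f. (\<Sum>i < j. card (?D i) * card (?D j)) + card (invs (?D j)))"
    by (intro sum.cong refl sum_if_less_delta) simp
  finally show ?thesis
    using card_inversions_word_of[OF K] card_inversions_word_of[OF A] card_inversions_word_of[OF generic_C]
    by (simp add: invs_between_self fin finK word_K sum.distrib)
qed

text \<open>Each block lies wholly on one side of a kernel point, horizontally and vertically, so it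
  adds either all of its points to the rank or none.\<close>

lemma norm_pt_kernel:
  assumes k: "k \<in> K"
  shows "norm_pt A k = (case norm_pt K k of (i, y) \<Rightarrow>
    (i + (\<Sum>c \<in> F. if snd c \<le> Suc i then card (C c) else 0), y + (\<Sum>c \<in> F. if fst c \<le> y then card (C c) else 0)))"
proof -
  have ne: "fst k \<noteq> fst q \<and> snd k \<noteq> snd q" if "q \<in> C c" for q c
  proof -
    have "q \<in> A" "k \<in> A" "k \<noteq> q" using that k KA by (auto simp: block_def)
    then show ?thesis using neq by simp
  qed
  have cx: "card {q \<in> C c. fst q < fst k} = (if snd c \<le> Suc (xrank K k) then card (C c) else 0)" for c
  proof -
    have "fst q < fst k \<longleftrightarrow> snd c \<le> Suc (xrank K k)" if "q \<in> C c" for q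
      using cell_of_left[OF finK k, of q] that ne[OF that] by (auto simp: block_def norm_pt_def)
    then have "{q \<in> C c. fst q < fst k} = (if snd c \<le> Suc (xrank K k) then C c else {})" by auto
    then show ?thesis by simp
  qed
  have x: "xrank A k = xrank K k + (\<Sum>c \<in> F. if snd c \<le> Suc (xrank K k) then card (C c) else 0)"
    unfolding cx[symmetric] unfolding xrank_def by (rule card_split)
  have cy: "card {q \<in> C c. snd q < snd k} = (if fst c \<le> Suc (yrank K k) then card (C c) else 0)" for c
  proof -
    have "snd q < snd k \<longleftrightarrow> fst c \<le> Suc (yrank K k)" if "q \<in> C c" for q
      using cell_of_below[OF finK k, of q] that ne[OF that] by (auto simp: block_def norm_pt_def)
    then have "{q \<in> C c. snd q < snd k} = (if fst c \<le> Suc (yrank K k) then C c else {})" by auto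
    then show ?thesis by simp
  qed
  have y: "yrank A k = yrank K k + (\<Sum>c \<in> F. if fst c \<le> Suc (yrank K k) then card (C c) else 0)"
    unfolding cy[symmetric] unfolding yrank_def by (rule card_split)
  show ?thesis unfolding norm_pt_def split x y by simp
qed

lemma norm_pt_block:
  assumes p: "p \<in> C c"
  shows "norm_pt A p = (case norm_pt (C c) p of (i, y) \<Rightarrow>
    (snd c - 1 + (\<Sum>d \<in> F. if d = c then i else if cell_prec d c then card (C d) else 0),
     fst c + (\<Sum>d \<in> F. if d = c then y - 1 else if cell_prec c d then card (C d) else 0)))"
proof -
  have c: "cell_of K p = c" "p \<in> A - K" using p unfolding block_def by blast+
  have cF: "c \<in> F" using feas[OF c(2)] c(1) by simp
  have d: "fst q < fst p \<and> snd p < snd q" if "cell_prec d c" "q \<in> C d" for q d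
    using that decr[OF _ c(2), of q] c(1) by (simp add: block_def)
  have d': "fst p < fst q \<and> snd q < snd p" if "cell_prec c d" "q \<in> C d" for q d
    using that decr[OF c(2), of q] c(1) by (simp add: block_def)
  have asym: "\<not> (cell_prec c d \<and> cell_prec d c)" for d by (cases c; cases d) (auto simp: cell_prec_def)
  have "card {q \<in> C d. fst q < fst p} = (if d = c then xrank (C c) p else if cell_prec d c then card (C d) else 0)"
    if dF: "d \<in> F" for d
  proof -
    consider "d = c" | "cell_prec d c" "d \<noteq> c" | "cell_prec c d" "d \<noteq> c"
      using feasible_cells_total[OF rho dF cF] by blast
    then show ?thesis
    proof cases
      case 1 then show ?thesis by (simp add: xrank_def)
    next
      case 2
      then have "{q \<in> C d. fst q < fst p} = C d" using d[OF 2(1)] by blast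
      then show ?thesis using 2 by simp
    next
      case 3
      then have "{q \<in> C d. fst q < fst p} = {}" using d'[OF 3(1)] less_asym by blast
      then show ?thesis using 3 asym by (metis card.empty)
    qed
  qed
  then have "xrank A p = xrank K p + (\<Sum>d \<in> F. if d = c then xrank (C c) p else if cell_prec d c then card (C d) else 0)"
    using card_split[of "\<lambda>q. fst q < fst p"] by (simp add: xrank_def)
  moreover have "card {q \<in> C d. snd q < snd p} = (if d = c then yrank (C c) p else if cell_prec c d then card (C d) else 0)"
    if dF: "d \<in> F" for d
  proof -
    consider "d = c" | "cell_prec d c" "d \<noteq> c" | "cell_prec c d" "d \<noteq> c"
      using feasible_cells_total[OF rho dF cF] by blast
    then show ?thesis
    proof cases
      case 1 then show ?thesis by (simp add: yrank_def)
    next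
      case 2
      then have "{q \<in> C d. snd q < snd p} = {}" using d[OF 2(1)] less_asym by blast
      then show ?thesis using 2 asym by (metis card.empty)
    next
      case 3
      then have "{q \<in> C d. snd q < snd p} = C d" using d'[OF 3(1)] by blast
      then show ?thesis using 3 by simp
    qed
  qed
  then have "yrank A p = yrank K p + (\<Sum>d \<in> F. if d = c then yrank (C c) p else if cell_prec c d then card (C d) else 0)"
    using card_split[of "\<lambda>q. snd q < snd p"] by (simp add: yrank_def)
  \<comment> \<open>The kernel's share of both ranks is read off the cell. The column loses its
    1-based offset, whereas the row keeps it as the \<open>Suc\<close> of \<open>norm_pt\<close>;
    the \<open>y - 1\<close> removes the same \<open>Suc\<close> inside the block.\<close>
  moreover have "snd c = Suc (xrank K p)" "fst c = Suc (yrank K p)" using c(1) by (auto simp: cell_of_def)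
  ultimately show ?thesis by (simp add: norm_pt_def cong: if_cong)
qed

text \<open>The right-hand side mentions only \<rho> and the cell words, neither \<open>A\<close>
  nor \<open>K\<close>. This is why the decomposition is injective.\<close>

lemma pts_word_of_eq_rebuild: "pts (word_of A) = rebuild \<rho> (\<lambda>c. word_of (C c))"
proof -
  have 1: "norm_pt A ` K = (\<lambda>(i, y). (i + (\<Sum>c \<in> F. if snd c \<le> Suc i then card (C c) else 0),
      y + (\<Sum>c \<in> F. if fst c \<le> y then card (C c) else 0))) ` pts \<rho>"
    unfolding pts_rho image_image by (rule image_cong[OF refl]) (rule norm_pt_kernel)
  have 2: "norm_pt A ` C c = (\<lambda>(i, y).
      (snd c - 1 + (\<Sum>d \<in> F. if d = c then i else if cell_prec d c then card (C d) else 0),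
       fst c + (\<Sum>d \<in> F. if d = c then y - 1 else if cell_prec c d then card (C d) else 0))) ` pts (word_of (C c))" for c
    unfolding pts_word_of[OF generic_C] image_image by (rule image_cong[OF refl]) (rule norm_pt_block)
  have 3: "norm_pt A ` A = norm_pt A ` K \<union> (\<Union>c \<in> F. norm_pt A ` C c)"
    by (subst (2) A_split) (simp add: image_Un image_UN)
  show ?thesis unfolding pts_word_of[OF A] rebuild_def 3 1 2 length_word_of ..
qed

end

section \<open>Words and their decompositions\<close>

lemma layout_kset:
  assumes A: "generic A" shows "layout (word_of (kset A)) A (kset A)"
proof
  show "p \<in> A - kset A \<Longrightarrow> cell_of (kset A) p \<in> feasible_cells (word_of (kset A))" for p
    using nonkernel_feasible[OF A] by simp
  show "p \<in> A - kset A \<Longrightarrow> q \<in> A - kset A \<Longrightarrow> cell_prec (cell_of (kset A) p) (cell_of (kset A) q) \<Longrightarrow>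
      fst p < fst q \<and> snd q < snd p" for p q
    using nonkernel_cells_decreasing[OF A] by simp
qed (use A kset_subset kset_word[OF A] in auto)

lemma layout_unique:
  assumes "layout \<rho> A K" "layout \<rho> A' K'"
    and "\<And>c. c \<in> feasible_cells \<rho> \<Longrightarrow> word_of (block A K c) = word_of (block A' K' c)"
  shows "word_of A = word_of A'"
proof -
  \<comment> \<open>At infeasible cells both blocks are empty, so the two families agree as
    functions of the cell.\<close>
  have "word_of (block A K c) = word_of (block A' K' c)" for c
    using assms(3) layout.C_empty[OF assms(1)] layout.C_empty[OF assms(2)]
    by (cases "c \<in> feasible_cells \<rho>") simp_all
  then have "pts (word_of A) = pts (word_of A')"
    unfolding layout.pts_word_of_eq_rebuild[OF assms(1)] layout.pts_word_of_eq_rebuild[OF assms(2)] by simp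
  then show ?thesis by (rule pts_inject)
qed

lemma filter_image_eq: "(\<And>x. x \<in> B \<Longrightarrow> P (g x) \<longleftrightarrow> Q x) \<Longrightarrow> {y \<in> g ` B. P y} = g ` {x \<in> B. Q x}"
  by blast

lemma word_of_image:
  assumes B: "generic B" and gB: "generic (g ` B)"
    and x: "\<And>p q. p \<in> B \<Longrightarrow> q \<in> B \<Longrightarrow> fst (g p) < fst (g q) \<longleftrightarrow> fst p < fst q"
    and y: "\<And>p q. p \<in> B \<Longrightarrow> q \<in> B \<Longrightarrow> snd (g p) < snd (g q) \<longleftrightarrow> snd p < snd q"
  shows "word_of (g ` B) = word_of B"
proof (rule pts_inject)
  have inj: "inj_on g B"
  proof (rule inj_onI)
    fix p q assume "p \<in> B" "q \<in> B" "g p = g q"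
    then have "fst p = fst q" using x[of p q] x[of q p] by simp
    then show "p = q" using generic_fst_eq[OF B] \<open>p \<in> B\<close> \<open>q \<in> B\<close> by simp
  qed
  have "norm_pt (g ` B) (g p) = norm_pt B p" if p: "p \<in> B" for p
  proof -
    have "{q \<in> g ` B. fst q < fst (g p)} = g ` {q \<in> B. fst q < fst p}"
      using x p by (intro filter_image_eq) simp
    moreover have "inj_on g {q \<in> B. fst q < fst p}" using inj by (auto intro: inj_on_subset)
    moreover have "{q \<in> g ` B. snd q < snd (g p)} = g ` {q \<in> B. snd q < snd p}"
      using y p by (intro filter_image_eq) simp
    moreover have "inj_on g {q \<in> B. snd q < snd p}" using inj by (auto intro: inj_on_subset)
    ultimately show ?thesis by (simp add: norm_pt_def xrank_def yrank_def card_image)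
  qed
  then have "norm_pt (g ` B) ` g ` B = norm_pt B ` B" by (simp add: image_image)
  then show "pts (word_of (g ` B)) = pts (word_of B)" by (simp add: pts_word_of B gB)
qed

lemma generic_norm_pt_image: "generic A \<Longrightarrow> generic (norm_pt A ` A)"
  using generic_pts[of "word_of A"] word_of_perm_words[of A] pts_word_of[of A] by (simp add: perm_words_def)

lemma word_of_norm_pt_image:
  assumes A: "generic A" and B: "B \<subseteq> A"
  shows "word_of (norm_pt A ` B) = word_of B"
proof (rule word_of_image)
  show "generic B" using generic_subset[OF A B] .
  show "generic (norm_pt A ` B)" using generic_subset[OF generic_norm_pt_image[OF A] image_mono[OF B]] .
qed (use A B fst_norm_pt_less[OF A] snd_norm_pt_less[OF A] in auto)

lemma cell_of_norm_pt_image: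
  assumes A: "generic A" and B: "B \<subseteq> A" and p: "p \<in> A"
  shows "cell_of (norm_pt A ` B) (norm_pt A p) = cell_of B p"
proof -
  let ?g = "norm_pt A"
  have inj: "inj_on ?g C" if "C \<subseteq> B" for C
    using inj_on_subset[OF inj_on_norm_pt[OF A]] that B by auto
  have "{q \<in> ?g ` B. fst q < fst (?g p)} = ?g ` {q \<in> B. fst q < fst p}"
    using B fst_norm_pt_less[OF A] by (intro filter_image_eq) blast
  moreover have "{q \<in> ?g ` B. snd q < snd (?g p)} = ?g ` {q \<in> B. snd q < snd p}"
    using B snd_norm_pt_less[OF A] by (intro filter_image_eq) blast
  ultimately show ?thesis
    using card_image[OF inj, of "{q \<in> B. fst q < fst p}"] card_image[OF inj, of "{q \<in> B. snd q < snd p}"]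
    by (simp add: cell_of_def xrank_def yrank_def)
qed

definition cell_words :: "nat list \<Rightarrow> nat list list" where
  "cell_words w = map (\<lambda>c. word_of (block (pts w) (kset (pts w)) c)) (cell_list (kernel_shape w))"

text \<open>Standardizing \<open>A\<close> carries its kernel \<open>K\<close> to the kernel of the
  word, and standardizing that image gives the same word as standardizing \<open>K\<close>
  directly.\<close>

lemma kernel_shape_word_of:
  assumes "layout \<rho> A K" shows "kernel_shape (word_of A) = \<rho>"
proof -
  interpret layout \<rho> A K by fact
  have "kset (pts (word_of A)) = norm_pt A ` K"
    unfolding pts_word_of[OF A] kset_norm_pt[OF A] kset_eq ..
  then show ?thesis
    using kernel_shape_eq[OF word_of_perm_words[OF A]] word_of_norm_pt_image[OF A KA] word_K by simp
qed

lemma cell_words_word_of: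
  assumes "layout \<rho> A K"
  shows "cell_words (word_of A) = map (\<lambda>c. word_of (block A K c)) (cell_list \<rho>)"
proof -
  interpret layout \<rho> A K by fact
  have kset: "kset (pts (word_of A)) = norm_pt A ` K"
    unfolding pts_word_of[OF A] kset_norm_pt[OF A] kset_eq ..
  have "block (pts (word_of A)) (kset (pts (word_of A))) c = norm_pt A ` C c" for c
  proof -
    have "norm_pt A ` A - norm_pt A ` K = norm_pt A ` (A - K)"
      using inj_on_image_set_diff[OF inj_on_norm_pt[OF A], of A K] KA by auto
    then have "block (norm_pt A ` A) (norm_pt A ` K) c =
        {q \<in> norm_pt A ` (A - K). cell_of (norm_pt A ` K) q = c}" by (simp only: block_def)
    also have "\<dots> = norm_pt A ` {p \<in> A - K. cell_of K p = c}"
      using cell_of_norm_pt_image[OF A KA] by (intro filter_image_eq) simp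
    finally show ?thesis unfolding kset unfolding pts_word_of[OF A] block_def .
  qed
  then show ?thesis
    unfolding cell_words_def kernel_shape_word_of[OF assms] using word_of_norm_pt_image[OF A C_subset] by simp
qed

lemma layout_word:
  assumes "w \<in> perm_words"
  shows "layout (kernel_shape w) (pts w) (kset (pts w))"
  using layout_kset[OF generic_pts] kernel_shape_eq[OF assms] assms by (simp add: perm_words_def)

lemma kernel_shape_perm:
  assumes "w \<in> perm_words"
  shows "kernel_shape w \<in> perm_words" "conn (pts (kernel_shape w))"
  using layout.rho[OF layout_word[OF assms]] by auto

lemma cell_words_perm:
  assumes "w \<in> perm_words"
  shows "length (cell_words w) = num_feasible (kernel_shape w)" "set (cell_words w) \<subseteq> perm_words"
  using length_cell_list[OF kernel_shape_perm[OF assms]] word_of_perm_words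
    layout.generic_C[OF layout_word[OF assms]] by (auto simp: cell_words_def)

lemma decomposition_inject:
  assumes w: "w \<in> perm_words" "w' \<in> perm_words"
    and eq: "kernel_shape w = kernel_shape w'" "cell_words w = cell_words w'"
  shows "w = w'"
proof -
  have "word_of (block (pts w) (kset (pts w)) c) = word_of (block (pts w') (kset (pts w')) c)"
    if "c \<in> feasible_cells (kernel_shape w)" for c
    using eq that set_cell_list[OF kernel_shape_perm[OF w(1)]] by (simp add: cell_words_def)
  then have "word_of (pts w) = word_of (pts w')"
    using layout_unique[OF layout_word[OF w(1)]] layout_word[OF w(2)] eq(1) by simp
  then show ?thesis using word_of_pts w by simp
qed

lemma
  assumes w: "w \<in> perm_words"
  shows length_decomposition: "length w = length (kernel_shape w) +
      (\<Sum>j < num_feasible (kernel_shape w). length (cell_words w ! j))" (is ?len)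
    and num132_decomposition: "num132 w = num132 (kernel_shape w) +
      (\<Sum>j < num_feasible (kernel_shape w). num132 (cell_words w ! j))" (is ?num)
    and inversions_decomposition: "card (inversions w) = card (inversions (kernel_shape w))
      + (\<Sum>j < num_feasible (kernel_shape w). \<Sum>i < j. length (cell_words w ! i) * length (cell_words w ! j))
      + (\<Sum>j < num_feasible (kernel_shape w). lcount (kernel_shape w) j * length (cell_words w ! j))
      + (\<Sum>j < num_feasible (kernel_shape w). card (inversions (cell_words w ! j)))" (is ?inv)
proof -
  interpret layout "kernel_shape w" "pts w" "kset (pts w)" using layout_word[OF w] .
  have nth: "cell_words w ! j = word_of (C (cell_list (kernel_shape w) ! j))" if "j < num_feasible (kernel_shape w)" for j
    using that length_cell_list[OF rho] by (simp add: cell_words_def)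
  show ?len using card_A unfolding sum_cells by (simp add: nth card_pts)
  show ?num using num132_split unfolding sum_cells by (simp add: nth word_of_pts w)
  show ?inv using card_inversions_split by (simp add: nth word_of_pts w)
qed

section \<open>Inflating a kernel shape\<close>

text \<open>Three-digit numbers in mixed radix: the leading digit records the position relative to the
  kernel, the middle one the cell, and the last one the position inside the cell.\<close>

locale mixed_radix =
  fixes f N :: nat assumes N: "0 < N"
begin

definition enc :: "nat \<Rightarrow> nat \<Rightarrow> nat \<Rightarrow> nat" where
  "enc a b c = (a * Suc f + b) * N + c"

lemma pair_less: "c < M \<Longrightarrow> c' < M \<Longrightarrow> x * M + c < x' * M + c' \<longleftrightarrow> x < x' \<or> x = x' \<and> c < c'"
  for x x' c c' M :: nat
proof -
  assume c: "c < M" "c' < M"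
  have "x * M + c < y * M + d" if "x < y" "c < M" for x y c d
  proof -
    have "Suc x * M \<le> y * M" using that by (intro mult_le_mono1) simp
    then show ?thesis using that by simp
  qed
  from this[of x x' c c'] this[of x' x c' c] c show ?thesis by (cases x x' rule: linorder_cases) auto
qed

lemma enc_less:
  "b \<le> f \<Longrightarrow> b' \<le> f \<Longrightarrow> c < N \<Longrightarrow> c' < N \<Longrightarrow>
   enc a b c < enc a' b' c' \<longleftrightarrow> a < a' \<or> a = a' \<and> (b < b' \<or> b = b' \<and> c < c')"
  unfolding enc_def using pair_less[of c N c'] pair_less[of b "Suc f" b' a a']
    pair_less[of b "Suc f" b' a a'] pair_less[of b' "Suc f" b a' a] by auto

lemma enc_eq:
  "b \<le> f \<Longrightarrow> b' \<le> f \<Longrightarrow> c < N \<Longrightarrow> c' < N \<Longrightarrow>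
   enc a b c = enc a' b' c' \<longleftrightarrow> a = a' \<and> b = b' \<and> c = c'"
  using enc_less[of b b' c c' a a'] enc_less[of b' b c' c a' a] by (metis less_irrefl linorder_neqE_nat)

end

text \<open>Surjectivity of the decomposition. Copies of \<rho> and of the words are placed by
  explicit coordinates; once the placement is seen to be a \<open>layout\<close>, the kernel and the
  blocks are identified by the general theory.\<close>

lemma inflation_exists:
  assumes \<rho>: "\<rho> \<in> perm_words" "conn (pts \<rho>)"
    and len: "length ws = num_feasible \<rho>" and ws: "set ws \<subseteq> perm_words"
  obtains w where "w \<in> perm_words" "kernel_shape w = \<rho>" "cell_words w = ws"
proof -
  define f where "f = num_feasible \<rho>"
  define cs where "cs = cell_list \<rho>"
  \<comment> \<open>Exceeds every position and every value of every word, so each of them fits into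
    the last digit.\<close>
  define N where "N = Suc (sum_list (map length ws))"
  interpret mixed_radix f N by unfold_locales (simp add: N_def)
  define row where "row j = fst (cs ! j) - 1" for j
  define col where "col j = snd (cs ! j) - 1" for j
  have len_cs: "length cs = f" using length_cell_list[OF \<rho>] by (simp add: cs_def f_def)
  have set_cs: "set cs = feasible_cells \<rho>" using set_cell_list[OF \<rho>] by (simp add: cs_def)
  have dist_cs: "distinct cs" using distinct_cell_list[OF \<rho>] by (simp add: cs_def)
  have cs: "cs ! j = (Suc (row j), Suc (col j)) \<and> row j < length \<rho> \<and> col j \<le> length \<rho>" if "j < f" for j
  proof -
    have "(fst (cs ! j), snd (cs ! j)) \<in> feasible_cells \<rho>" using that len_cs set_cs nth_mem[of j cs] by simp
    then show ?thesis by (cases "cs ! j") (auto simp: row_def col_def in_feasible_cells_iff)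
  qed
  have prec: "row j \<le> row i \<and> col i \<le> col j" if "i < j" "j < f" for i j
    using sorted_wrt_nth_less[OF sorted_cell_list[OF \<rho>], of i j] that len_cs
    by (auto simp: cs_def[symmetric] cell_prec_def row_def col_def)
  \<comment> \<open>Kernel points have middle digit 0, and a cell takes as leading digits the
    numbers of kernel points left of it and below it. Its middle digit is positive, which puts it
    just behind the last of these points. The abscissa of a kernel point is raised by one so that it
    counts the kernel points up to and including itself.\<close>
  define kern :: "nat \<times> nat \<Rightarrow> nat \<times> nat" where "kern = (\<lambda>(i, y). (enc (Suc i) 0 0, enc y 0 0))"
  \<comment> \<open>Cells sharing a column go rightwards by \<open>Suc j\<close>, and cells sharing
    a row go downwards by \<open>f - j\<close>; both digits lie between 1 and
    \<open>f\<close>.\<close>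
  define emb :: "nat \<Rightarrow> nat \<times> nat \<Rightarrow> nat \<times> nat" where
    "emb j = (\<lambda>(i, y). (enc (col j) (Suc j) i, enc (row j) (f - j) y))" for j
  define K where "K = kern ` pts \<rho>"
  define B where "B j = emb j ` pts (ws ! j)" for j
  define A where "A = K \<union> (\<Union>j < f. B j)"
  have ws_perm: "ws ! j \<in> perm_words" if "j < f" for j using that len ws by (auto simp: f_def)
  have bound: "i < N \<and> y < N" if "(i, y) \<in> pts (ws ! j)" "j < f" for i y j
  proof -
    have "length (ws ! j) < N"
      using that(2) len member_le_sum_list[of "length (ws ! j)" "map length ws"] by (auto simp: N_def f_def less_Suc_eq_le)
    moreover have "i < length (ws ! j)" "y \<le> length (ws ! j)"
      using that ws_perm[OF that(2)] nth_mem[of i "ws ! j"] by (auto simp: pts_def perm_words_def)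
    ultimately show ?thesis by simp
  qed
  have kernD: "\<exists>i y. (i, y) \<in> pts \<rho> \<and> p = (enc (Suc i) 0 0, enc y 0 0)" if "p \<in> K" for p
    using that by (force simp: K_def kern_def)
  have BD: "\<exists>i y. (i, y) \<in> pts (ws ! j) \<and> i < N \<and> y < N \<and> p = (enc (col j) (Suc j) i, enc (row j) (f - j) y)"
    if "p \<in> B j" "j < f" for p j
    using that bound[OF _ that(2)] by (force simp: B_def emb_def)
  have g\<rho>: "generic (pts \<rho>)" using \<rho>(1) by (simp add: perm_words_def generic_pts)
  have gws: "generic (pts (ws ! j))" if "j < f" for j using ws_perm[OF that] by (simp add: perm_words_def generic_pts)
  have KB: "fst p \<noteq> fst q \<and> snd p \<noteq> snd q" if h: "p \<in> K" "q \<in> B j" "j < f" for p q j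
  proof -
    obtain i y where p: "p = (enc (Suc i) 0 0, enc y 0 0)" using kernD[OF h(1)] by blast
    obtain i' y' where q: "i' < N" "y' < N" "q = (enc (col j) (Suc j) i', enc (row j) (f - j) y')"
      using BD[OF h(2,3)] by blast
    show ?thesis using h(3) q N by (simp add: p enc_eq)
  qed
  have BB: "fst p \<noteq> fst q \<and> snd p \<noteq> snd q" if h: "p \<in> B i" "q \<in> B j" "i < f" "j < f" "i \<noteq> j" for p q i j
  proof -
    obtain x y where p: "x < N" "y < N" "p = (enc (col i) (Suc i) x, enc (row i) (f - i) y)"
      using BD[OF h(1,3)] by blast
    obtain x' y' where q: "x' < N" "y' < N" "q = (enc (col j) (Suc j) x', enc (row j) (f - j) y')"
      using BD[OF h(2,4)] by blast
    have "f - i \<noteq> f - j" using h by simp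
    then show ?thesis using h p q by (simp add: enc_eq)
  qed
  have KK: "p = q" if pq: "p \<in> K" "q \<in> K" "fst p = fst q \<or> snd p = snd q" for p q
  proof -
    obtain i y where p: "(i, y) \<in> pts \<rho>" "p = (enc (Suc i) 0 0, enc y 0 0)" using kernD[OF pq(1)] by blast
    obtain i' y' where q: "(i', y') \<in> pts \<rho>" "q = (enc (Suc i') 0 0, enc y' 0 0)" using kernD[OF pq(2)] by blast
    have "i = i' \<or> y = y'" using pq(3) N by (simp add: p q enc_eq)
    then show ?thesis using generic_fst_eq[OF g\<rho> p(1) q(1)] generic_snd_eq[OF g\<rho> p(1) q(1)] p(2) q(2) by auto
  qed
  have BBs: "p = q" if pq: "p \<in> B j" "q \<in> B j" "j < f" "fst p = fst q \<or> snd p = snd q" for p q j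
  proof -
    obtain x y where p: "(x, y) \<in> pts (ws ! j)" "x < N" "y < N" "p = (enc (col j) (Suc j) x, enc (row j) (f - j) y)"
      using BD[OF pq(1,3)] by blast
    obtain x' y' where q: "(x', y') \<in> pts (ws ! j)" "x' < N" "y' < N" "q = (enc (col j) (Suc j) x', enc (row j) (f - j) y')"
      using BD[OF pq(2,3)] by blast
    have "x = x' \<or> y = y'" using pq p q by (simp add: enc_eq)
    then show ?thesis
      using generic_fst_eq[OF gws[OF pq(3)] p(1) q(1)] generic_snd_eq[OF gws[OF pq(3)] p(1) q(1)] p(4) q(4) by auto
  qed
  have eq: "p = q" if pq: "p \<in> A" "q \<in> A" "fst p = fst q \<or> snd p = snd q" for p q
  proof -
    have "p \<in> K \<or> (\<exists>i < f. p \<in> B i)" "q \<in> K \<or> (\<exists>i < f. q \<in> B i)" using pq by (auto simp: A_def)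
    then show ?thesis using KK[of p q] KB[of p q] KB[of q p] BB[of p _ q] BBs[of p _ q] pq(3) by metis
  qed
  have "finite (pts v)" for v by (simp add: pts_def)
  then have "finite A" by (auto simp: A_def K_def B_def)
  then have gA: "generic A" unfolding generic_def using eq by (blast intro: inj_onI)
  have KA: "K \<subseteq> A" and BA: "\<And>j. j < f \<Longrightarrow> B j \<subseteq> A" by (auto simp: A_def)
  have word_K: "word_of K = \<rho>"
  proof -
    have "word_of (kern ` pts \<rho>) = word_of (pts \<rho>)"
      using g\<rho> generic_subset[OF gA KA] N by (intro word_of_image) (auto simp: K_def kern_def enc_less)
    then show ?thesis using word_of_pts[OF \<rho>(1)] by (simp add: K_def)
  qed
  have word_B: "word_of (B j) = ws ! j" if j: "j < f" for j
  proof -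
    have "word_of (emb j ` pts (ws ! j)) = word_of (pts (ws ! j))"
    proof (rule word_of_image)
      show "generic (pts (ws ! j))" using gws[OF j] .
      show "generic (emb j ` pts (ws ! j))" using generic_subset[OF gA BA[OF j]] by (simp add: B_def)
      fix p q assume "p \<in> pts (ws ! j)" "q \<in> pts (ws ! j)"
      then show "fst (emb j p) < fst (emb j q) \<longleftrightarrow> fst p < fst q" "snd (emb j p) < snd (emb j q) \<longleftrightarrow> snd p < snd q"
        using bound[of "fst p" "snd p" j] bound[of "fst q" "snd q" j] j
        by (simp_all add: emb_def enc_less case_prod_beta)
    qed
    then show ?thesis using word_of_pts[OF ws_perm[OF j]] by (simp add: B_def)
  qed
  have inj_kern: "inj_on kern S" for S using N by (auto simp: inj_on_def kern_def enc_eq)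
  have cell_B: "cell_of K p = cs ! j" if p: "p \<in> B j" and j: "j < f" for p j
  proof -
    obtain x y where xy: "x < N" "y < N" "p = (enc (col j) (Suc j) x, enc (row j) (f - j) y)"
      using BD[OF p j] by blast
    \<comment> \<open>The point \<open>(col j, Suc (row j))\<close> stands for the cell in the grid
      of \<rho>. The strict comparisons match because a tie in the leading digit is decided against
      the middle digit 0 of the kernel.\<close>
    have "{k \<in> K. fst k < fst p} = kern ` {k \<in> pts \<rho>. fst k < fst (col j, Suc (row j))}"
      unfolding K_def using xy j N by (intro filter_image_eq) (auto simp: kern_def enc_less)
    then have "xrank K p = xrank (pts \<rho>) (col j, Suc (row j))"
      by (simp only: xrank_def card_image[OF inj_kern])
    moreover have "{k \<in> K. snd k < snd p} = kern ` {k \<in> pts \<rho>. snd k < snd (col j, Suc (row j))}"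
      unfolding K_def using xy j N by (intro filter_image_eq) (auto simp: kern_def enc_less)
    then have "yrank K p = yrank (pts \<rho>) (col j, Suc (row j))"
      by (simp only: yrank_def card_image[OF inj_kern])
    ultimately show ?thesis
      using cs[OF j] xrank_pts[of "col j" \<rho> "Suc (row j)"] yrank_pts[OF \<rho>(1), of "Suc (row j)" "col j"]
      by (simp add: cell_of_def)
  qed
  have AK: "\<exists>j < f. p \<in> B j" if "p \<in> A - K" for p using that by (auto simp: A_def)
  have lay: "layout \<rho> A K"
  proof
    fix p assume "p \<in> A - K"
    then obtain j where "j < f" "p \<in> B j" using AK by blast
    then show "cell_of K p \<in> feasible_cells \<rho>" using cell_B set_cs len_cs nth_mem by metis
  next
    fix p q assume "p \<in> A - K" "q \<in> A - K" and pr: "cell_prec (cell_of K p) (cell_of K q)"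
    then obtain i j where i: "i < f" "p \<in> B i" and j: "j < f" "q \<in> B j" using AK by blast
    have pr: "cell_prec (cs ! i) (cs ! j)" using pr cell_B i j by simp
    have "i < j"
    proof (rule ccontr)
      assume "\<not> i < j"
      then consider "i = j" | "j < i" by linarith
      then show False
      proof cases
        case 1 then show False using pr by (auto simp: cell_prec_def)
      next
        case 2
        have "cell_prec (cs ! j) (cs ! i)"
          using sorted_wrt_nth_less[OF sorted_cell_list[OF \<rho>], of j i] 2 i len_cs by (simp add: cs_def)
        with pr show False by (auto simp: cell_prec_def)
      qed
    qed
    obtain x y where p: "x < N" "y < N" "p = (enc (col i) (Suc i) x, enc (row i) (f - i) y)"
      using BD i by blast
    obtain x' y' where q: "x' < N" "y' < N" "q = (enc (col j) (Suc j) x', enc (row j) (f - j) y')"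
      using BD j by blast
    show "fst p < fst q \<and> snd q < snd p"
      using prec[OF \<open>i < j\<close> j(1)] \<open>i < j\<close> j(1) p q by (auto simp: enc_less)
  qed (use gA KA \<rho> word_K in auto)
  have "block A K (cs ! j) = B j" if j: "j < f" for j
  proof (intro equalityI subsetI)
    fix p assume p: "p \<in> block A K (cs ! j)"
    then obtain i where i: "i < f" "p \<in> B i" using AK[of p] unfolding block_def by blast
    then have "cs ! i = cs ! j" using p cell_B by (simp add: block_def)
    then have "i = j" using dist_cs len_cs i(1) j by (simp add: nth_eq_iff_index_eq)
    then show "p \<in> B j" using i by simp
  next
    fix p assume p: "p \<in> B j"
    then have "p \<notin> K" using KB[of p p j] j by auto
    then show "p \<in> block A K (cs ! j)" using p j BA[OF j] cell_B[OF p j] unfolding block_def by blast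
  qed
  then have "cell_words (word_of A) = ws"
    unfolding cell_words_word_of[OF lay] using word_B len len_cs
    by (intro nth_equalityI) (simp_all add: cs_def[symmetric] f_def[symmetric])
  then show ?thesis using that[OF word_of_perm_words[OF gA] kernel_shape_word_of[OF lay]] by blast
qed

lemma sum_list_map_nth: "sum_list (map g xs) = (\<Sum>j < length xs. g (xs ! j))"
  by (simp add: sum_list_sum_nth atLeast0LessThan)

section \<open>Kernel shapes in a given size\<close>

lemma kernel_shapes_conn:
  assumes "\<rho> \<in> kernel_shapes t"
  shows "\<rho> \<in> perm_words" "conn (pts \<rho>)"
  using assms kernel_shape_perm by (auto simp: kernel_shapes_def permutations_of_set_iff simp del: One_nat_def)

lemma conn_in_kernel_shapes:
  assumes \<rho>: "\<rho> \<in> perm_words" "conn (pts \<rho>)" and len: "1 \<le> length \<rho>" "length \<rho> \<le> t"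
  shows "\<rho> \<in> kernel_shapes t"
proof -
  let ?f = "num_feasible \<rho>"
  have "1 \<le> \<rho> ! i" if "i < length \<rho>" for i
    using \<rho>(1) nth_mem[OF that] by (simp add: perm_words_def)
  \<comment> \<open>The cell below and to the right of everything has no entry on its right and none
    below, and every obstruction needs one of these. So there is at least one feasible cell.\<close>
  then have "(1, Suc (length \<rho>)) \<in> feasible_cells \<rho>"
    using len by (fastforce simp: in_feasible_cells_iff obstructed_def pts_def)
  then have "?f > 0" unfolding num_feasible_def using finite_feasible_cells card_gt_0_iff by blast
  let ?v = "[1..<Suc (t - length \<rho>)]"
  \<comment> \<open>All missing entries go into the first cell of the list; any word of this length
    would serve.\<close>
  let ?ws = "?v # replicate (?f - 1) []"
  have "?v \<in> perm_words" "[] \<in> perm_words" by (auto simp: perm_words_def)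
  then have "set ?ws \<subseteq> perm_words" by auto
  then obtain w where w: "w \<in> perm_words" "kernel_shape w = \<rho>" "cell_words w = ?ws"
    using inflation_exists[OF \<rho>, of ?ws] \<open>?f > 0\<close> by auto
  have "length ?ws = ?f" using \<open>?f > 0\<close> by simp
  then have "(\<Sum>j < ?f. length (?ws ! j)) = sum_list (map length ?ws)"
    unfolding sum_list_map_nth by (simp only:)
  also have "\<dots> = t - length \<rho>" by (simp add: sum_list_replicate del: upt_Suc)
  finally have "length w = t" using length_decomposition[OF w(1)] w len by simp
  then show ?thesis unfolding kernel_shapes_def using w permutations_of_set_iff by blast
qed

text \<open>The kernel is connected and has at most \<open>num132 w\<close> occurrences, which
  bounds its size. It is nonempty because it contains the maximal entry of \<open>w\<close>.\<close>

lemma kernel_shape_in_kernel_shapes: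
  assumes w: "w \<in> perm_words" "w \<noteq> []"
  shows "kernel_shape w \<in> kernel_shapes (2 * num132 w + 1)"
proof -
  let ?K = "kset (pts w)"
  have gw: "generic (pts w)" using w by (simp add: perm_words_def generic_pts)
  have gK: "generic ?K" using generic_subset[OF gw kset_subset] .
  have "pts w \<noteq> {}" using w(2) by (auto simp: pts_def)
  then have "?K \<noteq> {}" using top_pts_nonempty[OF generic_finite[OF gw]] top_pts_subset_kset[of "pts w"] by auto
  then have "1 \<le> card ?K" using generic_finite[OF gK] by (simp add: Suc_le_eq card_gt_0_iff)
  moreover have "card ?K \<le> 2 * card (occs ?K) + 1" using card_conn_le[OF gK conn_kset] .
  moreover have "card (occs ?K) \<le> card (occs (pts w))"
    using occs_mono[OF kset_subset] finite_occs[OF generic_finite[OF gw]] by (rule card_mono[rotated])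
  ultimately show ?thesis
    using kernel_shape_perm[OF w(1)] kernel_shape_eq[OF w(1)] card_occs_pts[of w]
    by (intro conn_in_kernel_shapes) auto
qed

section \<open>Generating functions\<close>

lemma word_sign_cases: "word_sign w = 1 \<or> word_sign w = -1"
  by (cases "even (card (inversions w))") (simp_all add: word_sign_def)

text \<open>The permutations enumerated by \<open>H_gf r v u\<close>, for bits \<open>v\<close> and
  \<open>u\<close>.\<close>

definition class_words :: "nat \<Rightarrow> nat \<Rightarrow> nat \<Rightarrow> nat list set" where
  "class_words r v u = {w \<in> perm_words. num132 w = r \<and> length w mod 2 = v \<and> word_sign w = (-1) ^ u}"

lemma finite_perm_words_length: "finite {w \<in> perm_words. length w = n}"
proof -
  have "{w \<in> perm_words. length w = n} = permutations_of_set {1..n}"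
    using permutations_of_set_iff by blast
  then show ?thesis by simp
qed

lemma fps_compose_uminus_X_nth: "fps_nth (G oo - fps_X) n = (-1) ^ n * fps_nth (G :: rat fps) n"
proof -
  have "fps_nth ((- fps_X :: rat fps) ^ i) n = (if n = i then (-1) ^ i else 0)" for i
    by (cases "even i") (simp_all add: fps_X_power_iff)
  then have "fps_nth (G oo - fps_X) n = (\<Sum>i = 0..n. if n = i then (-1) ^ i * fps_nth G i else 0)"
    unfolding fps_compose_nth by (intro sum.cong) auto
  then show ?thesis by simp
qed

text \<open>The symmetrization multiplies the coefficient of degree \<open>n\<close> by half of 1 +
  (-1)^(v + n), which is 1 if \<open>n\<close> has parity \<open>v\<close> and 0 otherwise.\<close>

lemma H_gf_nth:
  assumes "v \<in> {0, 1}" "u \<in> {0, 1}"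
  shows "fps_nth (H_gf r v u) n = of_nat (card {w \<in> class_words r v u. length w = n})"
proof -
  define G where "G = (if u = 0 then E_gf r else O_gf r)"
  have G: "fps_nth G n = of_nat (card {w \<in> perm_words. length w = n \<and> word_sign w = (-1) ^ u \<and> num132 w = r})"
  proof -
    have "{p \<in> permutations_of_set {1..n}. word_sign p = s \<and> num132 p = r} =
        {w \<in> perm_words. length w = n \<and> word_sign w = s \<and> num132 w = r}" for s
      using permutations_of_set_iff by blast
    then show ?thesis using assms(2) by (auto simp: G_def E_gf_def O_gf_def even_count_def odd_count_def)
  qed
  have "fps_nth ((-1) ^ v * (G oo - fps_X)) n = (-1) ^ v * ((-1) ^ n * fps_nth G n)"
    using assms(1) by (auto simp: fps_compose_uminus_X_nth)
  then have H: "fps_nth (H_gf r v u) n = 1/2 * (fps_nth G n + (-1) ^ v * ((-1) ^ n * fps_nth G n))"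
    unfolding H_gf_def Let_def G_def[symmetric] by simp
  show ?thesis
  proof (cases "n mod 2 = v")
    case True
    then have "even (v + n)" by presburger
    then have e: "(-1) ^ v * ((-1) ^ n * fps_nth G n) = fps_nth G n"
      by (simp add: power_add[symmetric] mult.assoc[symmetric])
    have "{w \<in> perm_words. length w = n \<and> word_sign w = (-1) ^ u \<and> num132 w = r} =
        {w \<in> class_words r v u. length w = n}" using True by (auto simp: class_words_def)
    then show ?thesis using H[unfolded e] G by simp
  next
    case False
    then have "odd (v + n)" using assms(1) by (auto; presburger)
    then have e: "(-1) ^ v * ((-1) ^ n * fps_nth G n) = - fps_nth G n"
      by (simp add: power_add[symmetric] mult.assoc[symmetric])
    have "{w \<in> class_words r v u. length w = n} = {}" using False by (auto simp: class_words_def)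
    then have "card {w \<in> class_words r v u. length w = n} = 0" by (simp only: card.empty)
    then show ?thesis using H[unfolded e] by simp
  qed
qed

definition tuples :: "(nat \<Rightarrow> nat list set) \<Rightarrow> nat \<Rightarrow> nat \<Rightarrow> nat list list set" where
  "tuples S f n = {ws. length ws = f \<and> (\<forall>j < f. ws ! j \<in> S j) \<and> sum_list (map length ws) = n}"

text \<open>Induction on the number of components by splitting off the last word; the index
  \<open>i\<close> of the Cauchy product is the total length of the others. Finiteness is carried
  along because the cardinality of an infinite set would be 0.\<close>

lemma prod_nth_tuples:
  fixes G :: "nat \<Rightarrow> 'a :: comm_semiring_1 fps"
  assumes S: "\<And>j n. j < f \<Longrightarrow> finite {w \<in> S j. length w = n}"
    and G: "\<And>j n. j < f \<Longrightarrow> fps_nth (G j) n = of_nat (card {w \<in> S j. length w = n})"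
  shows "finite (tuples S f n) \<and> fps_nth (\<Prod>j < f. G j) n = of_nat (card (tuples S f n))"
  using assms
proof (induction f arbitrary: n)
  case 0
  have "tuples S 0 n = (if n = 0 then {[]} else {})" by (auto simp: tuples_def)
  then show ?case by simp
next
  case (Suc f)
  let ?I = "SIGMA i:{0..n}. tuples S f i \<times> {w \<in> S f. length w = n - i}"
  have IH: "finite (tuples S f i)" "fps_nth (\<Prod>j < f. G j) i = of_nat (card (tuples S f i))" for i
    using Suc.IH[of i] Suc.prems by simp_all
  have fin: "finite {w \<in> S f. length w = i}" for i using Suc.prems(1) by simp
  have bij: "bij_betw (\<lambda>(i, ws, w). ws @ [w]) ?I (tuples S (Suc f) n)"
  proof (rule bij_betw_imageI)
    show "inj_on (\<lambda>(i, ws, w). ws @ [w]) ?I" by (auto simp: inj_on_def tuples_def)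
    show "(\<lambda>(i, ws, w). ws @ [w]) ` ?I = tuples S (Suc f) n"
    proof (intro equalityI subsetI)
      fix vs assume vs: "vs \<in> tuples S (Suc f) n"
      then obtain ws w where ws: "vs = ws @ [w]" by (cases vs rule: rev_cases) (auto simp: tuples_def)
      have len: "length ws = f" and S: "\<And>j. j < Suc f \<Longrightarrow> (ws @ [w]) ! j \<in> S j"
        and n: "sum_list (map length ws) + length w = n"
        using vs by (auto simp: tuples_def ws)
      have "ws ! j \<in> S j" if "j < f" for j using S[of j] that len by (simp add: nth_append)
      moreover have "w \<in> S f" using S[of f] len by (simp add: nth_append)
      ultimately have "(sum_list (map length ws), ws, w) \<in> ?I" using n len by (auto simp: tuples_def)
      then show "vs \<in> (\<lambda>(i, ws, w). ws @ [w]) ` ?I" unfolding ws by (rule rev_image_eqI) simp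
    qed (auto simp: tuples_def nth_append less_Suc_eq)
  qed
  have "finite ?I" using IH(1) fin by (intro finite_SigmaI finite_cartesian_product) simp_all
  then have "card (tuples S (Suc f) n) = card ?I" "finite (tuples S (Suc f) n)"
    using bij_betw_same_card[OF bij] bij_betw_finite[OF bij] by simp_all
  moreover have "card ?I = (\<Sum>i = 0..n. card (tuples S f i) * card {w \<in> S f. length w = n - i})"
    using IH(1) fin by (simp add: card_SigmaI card_cartesian_product)
  ultimately show ?case
    using IH(2) Suc.prems(2)[of f] by (simp add: fps_mult_nth)
qed

section \<open>The sign of a decomposed permutation\<close>

lemma sum_mod_2_cong:
  fixes g h :: "'a \<Rightarrow> nat"
  assumes "\<And>x. x \<in> A \<Longrightarrow> g x mod 2 = h x mod 2"
  shows "sum g A mod 2 = sum h A mod 2"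
  using assms by (metis (mono_tags, lifting) mod_sum_eq sum.cong)

lemma minus_one_power_cong: "m mod 2 = n mod 2 \<Longrightarrow> (-1 :: int) ^ m = (-1) ^ n"
  by (metis even_iff_mod_2_eq_zero minus_one_power_iff)

lemma card_eq_sum_fibres:
  assumes "finite B" "finite I"
  shows "card {x \<in> B. h x \<in> I} = (\<Sum>t \<in> I. card {x \<in> B. h x = t})"
proof -
  have "{x \<in> B. h x \<in> I} = (\<Union>t \<in> I. {x \<in> B. h x = t})" by auto
  then show ?thesis using assms by (simp only:) (rule card_UN_disjoint, auto)
qed

definition combined_sign :: "nat list \<Rightarrow> nat list list \<Rightarrow> int" where
  "combined_sign \<rho> ws = word_sign \<rho> *
     (-1) ^ ((\<Sum>j < num_feasible \<rho>. \<Sum>i < j. length (ws ! i) * length (ws ! j)) +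
             (\<Sum>j < num_feasible \<rho>. lcount \<rho> j * length (ws ! j))) *
     (\<Prod>j < num_feasible \<rho>. word_sign (ws ! j))"

lemma word_sign_decomposition:
  assumes "w \<in> perm_words"
  shows "word_sign w = combined_sign (kernel_shape w) (cell_words w)"
  unfolding word_sign_def[of w] inversions_decomposition[OF assms] combined_sign_def
  by (simp add: power_add power_sum word_sign_def)

definition parities :: "nat list list \<Rightarrow> nat list" where
  "parities ws = map (\<lambda>w. length w mod 2) ws"

definition sign_bits :: "nat list list \<Rightarrow> nat list" where
  "sign_bits ws = map (\<lambda>w. if word_sign w = 1 then 0 else 1) ws"

text \<open>The lengths enter only through exponents of -1, so they may be replaced by their
  parities, and the product of the cell signs becomes a power with exponent the sum of the sign
  bits.\<close>

lemma combined_sign_eq: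
  assumes "length ws = num_feasible \<rho>"
  shows "combined_sign \<rho> ws = z_sign \<rho> (parities ws) * (-1) ^ sum_list (sign_bits ws)"
proof -
  let ?f = "num_feasible \<rho>" and ?v = "parities ws"
  have v: "?v ! j = length (ws ! j) mod 2" if "j < ?f" for j using that assms by (simp add: parities_def)
  have "(\<Sum>j < ?f. \<Sum>i < j. ?v ! i * ?v ! j) mod 2 = (\<Sum>j < ?f. \<Sum>i < j. length (ws ! i) * length (ws ! j)) mod 2"
    by (intro sum_mod_2_cong) (simp add: v mod_mult_eq)
  moreover have "(\<Sum>j < ?f. lcount \<rho> j * ?v ! j) mod 2 = (\<Sum>j < ?f. lcount \<rho> j * length (ws ! j)) mod 2"
    by (intro sum_mod_2_cong) (simp add: v mod_mult_right_eq)
  ultimately have "((\<Sum>j < ?f. \<Sum>i < j. ?v ! i * ?v ! j) + (\<Sum>j < ?f. lcount \<rho> j * ?v ! j)) mod 2 =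
    ((\<Sum>j < ?f. \<Sum>i < j. length (ws ! i) * length (ws ! j)) + (\<Sum>j < ?f. lcount \<rho> j * length (ws ! j))) mod 2"
    by (rule mod_add_cong)
  note pow = minus_one_power_cong[OF this]
  have "(-1) ^ (if word_sign w = 1 then 0 else 1) = word_sign w" for w
    using word_sign_cases[of w] by auto
  then have "(-1) ^ sum_list (sign_bits ws) = (\<Prod>j < ?f. word_sign (ws ! j))"
    unfolding sign_bits_def sum_list_map_nth assms power_sum by simp
  then show ?thesis unfolding combined_sign_def z_sign_def pow by simp
qed

section \<open>Coefficients of the contribution of one shape\<close>

definition shape_tuples :: "nat \<Rightarrow> nat \<Rightarrow> nat \<Rightarrow> nat list \<Rightarrow> nat \<Rightarrow> nat list list set" where
  "shape_tuples r a b \<rho> n = {ws. length ws = num_feasible \<rho> \<and> set ws \<subseteq> perm_words \<and>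
     length \<rho> + sum_list (map length ws) = n \<and> num132 \<rho> + sum_list (map num132 ws) = r \<and>
     n mod 2 = a \<and> combined_sign \<rho> ws = (-1) ^ b}"

lemma finite_bit_vectors: "finite (bit_vectors f)"
proof -
  have "bit_vectors f = {v. set v \<subseteq> {0, 1} \<and> length v = f}" by (auto simp: bit_vectors_def)
  then show ?thesis using finite_lists_length_eq[of "{0, 1 :: nat}" f] by simp
qed

lemma finite_distributions: "finite (distributions r \<rho>)"
proof -
  have "distributions r \<rho> \<subseteq> {rs. set rs \<subseteq> {..r} \<and> length rs = num_feasible \<rho>}"
    using member_le_sum_list by (fastforce simp: distributions_def)
  then show ?thesis using finite_lists_length_eq[of "{..r}"] finite_subset by blast
qed

lemma finite_tuples_perm_words: "finite (tuples (\<lambda>_. perm_words) f n)"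
  using prod_nth_tuples[of f "\<lambda>_. perm_words"
      "\<lambda>_. Abs_fps (\<lambda>n. of_nat (card {w \<in> perm_words. length w = n})) :: rat fps"]
    finite_perm_words_length by simp

lemma finite_shape_tuples: "finite (shape_tuples r a b \<rho> n)"
  by (rule finite_subset[OF _ finite_tuples_perm_words[of "num_feasible \<rho>" "n - length \<rho>"]])
    (auto simp: shape_tuples_def tuples_def)

text \<open>Each tuple of cell words has exactly one triple of capacities, parities and sign bits.
  The threefold sum over \<open>distributions\<close>, \<open>X_set\<close> and \<open>Y_set\<close>
  therefore adds up disjoint fibres, and its range is exactly the set of triples that give the right
  capacity, size parity and sign.\<close>

lemma L_gf_sum_nth:
  assumes a: "a \<in> {0, 1}" and n: "length \<rho> \<le> n"
  shows "fps_nth (\<Sum>rs \<in> distributions r \<rho>. L_gf \<rho> rs a b) (n - length \<rho>) =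
    of_nat (card (shape_tuples r a b \<rho> n))"
proof -
  let ?f = "num_feasible \<rho>" and ?s = "length \<rho>"
  let ?X = "X_set \<rho> ((-1) ^ a)" and ?Y = "\<lambda>v. Y_set \<rho> ((-1) ^ b * z_sign \<rho> v)"
  let ?I = "SIGMA rs:distributions r \<rho>. SIGMA v:?X. ?Y v"
  define h where "h ws = (map num132 ws, parities ws, sign_bits ws)" for ws
  define B where "B = tuples (\<lambda>_. perm_words) ?f (n - ?s)"
  have finB: "finite B"
    unfolding B_def by (rule finite_tuples_perm_words)
  have finX: "finite ?X" and finY: "finite (?Y v)" for v
    using finite_bit_vectors finite_subset by (auto simp: X_set_def Y_set_def)
  have finI: "finite ?I" using finite_distributions finX finY by (intro finite_SigmaI) auto
  have prod: "fps_nth (\<Prod>j < ?f. H_gf (rs ! j) (v ! j) (u ! j)) (n - ?s) = of_nat (card {ws \<in> B. h ws = (rs, v, u)})"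
    if "(rs, v, u) \<in> ?I" for rs v u
  proof -
    have len: "length rs = ?f" "length v = ?f" "length u = ?f" and "set v \<subseteq> {0, 1}" "set u \<subseteq> {0, 1}"
      using that by (auto simp: distributions_def X_set_def Y_set_def bit_vectors_def)
    then have bit: "v ! j \<in> {0, 1}" "u ! j \<in> {0, 1}" if "j < ?f" for j
      using that by (metis nth_mem subsetD)+
    let ?S = "\<lambda>j. class_words (rs ! j) (v ! j) (u ! j)"
    have "finite {w \<in> ?S j. length w = m}" for j m
      by (rule finite_subset[OF _ finite_perm_words_length[of m]]) (auto simp: class_words_def)
    then have "fps_nth (\<Prod>j < ?f. H_gf (rs ! j) (v ! j) (u ! j)) (n - ?s) = of_nat (card (tuples ?S ?f (n - ?s)))"
      using prod_nth_tuples[of ?f ?S "\<lambda>j. H_gf (rs ! j) (v ! j) (u ! j)"] H_gf_nth bit by blast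
    also have "tuples ?S ?f (n - ?s) = {ws \<in> B. h ws = (rs, v, u)}"
    proof -
      have "(\<forall>j < ?f. ws ! j \<in> ?S j) \<longleftrightarrow> (\<forall>j < ?f. ws ! j \<in> perm_words) \<and> h ws = (rs, v, u)"
        if ws: "length ws = ?f" for ws
      proof -
        have "word_sign w = (-1) ^ u ! j \<longleftrightarrow> (if word_sign w = 1 then 0 else 1) = u ! j" if j: "j < ?f" for w j
        proof -
          consider "u ! j = 0" | "u ! j = 1" using bit(2)[OF j] by auto
          then show ?thesis using word_sign_cases[of w] by cases auto
        qed
        then show ?thesis
          using ws len by (auto simp: h_def class_words_def parities_def sign_bits_def list_eq_iff_nth_eq)
      qed
      then show ?thesis unfolding B_def tuples_def by blast
    qed
    finally show ?thesis .
  qed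
  have "fps_nth (\<Sum>rs \<in> distributions r \<rho>. L_gf \<rho> rs a b) (n - ?s) =
    (\<Sum>rs \<in> distributions r \<rho>. \<Sum>v \<in> ?X. \<Sum>u \<in> ?Y v. of_nat (card {ws \<in> B. h ws = (rs, v, u)}))"
    unfolding L_gf_def fps_sum_nth using prod by (intro sum.cong refl) auto
  also have "\<dots> = (\<Sum>t \<in> ?I. of_nat (card {ws \<in> B. h ws = t}))"
    using finite_distributions finX finY by (simp add: sum.Sigma case_prod_beta)
  also have "\<dots> = of_nat (card {ws \<in> B. h ws \<in> ?I})"
    using card_eq_sum_fibres[OF finB finI] by simp
  also have "{ws \<in> B. h ws \<in> ?I} = shape_tuples r a b \<rho> n"
  proof -
    have "ws \<in> B \<and> h ws \<in> ?I \<longleftrightarrow> ws \<in> shape_tuples r a b \<rho> n" for ws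
    proof (cases "length ws = ?f \<and> set ws \<subseteq> perm_words \<and> ?s + sum_list (map length ws) = n")
      case True
      have "ws \<in> B" using True by (auto simp: B_def tuples_def)
      have bits: "parities ws \<in> bit_vectors ?f" "sign_bits ws \<in> bit_vectors ?f"
        using True by (auto simp: bit_vectors_def parities_def sign_bits_def)
      have "map num132 ws \<in> distributions r \<rho> \<longleftrightarrow> num132 \<rho> + sum_list (map num132 ws) = r"
        using True by (auto simp: distributions_def)
      \<comment> \<open>The exponent in \<open>X_set\<close> is congruent modulo 2 to the total size
        \<open>n\<close>.\<close>
      moreover have "parities ws \<in> ?X \<longleftrightarrow> n mod 2 = a"
      proof -
        have "sum_list (parities ws) mod 2 = sum_list (map length ws) mod 2"
          unfolding parities_def sum_list_map_nth by (rule sum_mod_2_cong) simp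
        then have "(sum_list (parities ws) + ?s) mod 2 = (sum_list (map length ws) + ?s) mod 2"
          by (rule mod_add_cong) simp
        moreover have "sum_list (map length ws) + ?s = n" using True by simp
        ultimately have "(sum_list (parities ws) + ?s) mod 2 = n mod 2" by (simp only:)
        then have "(-1 :: int) ^ (sum_list (parities ws) + ?s) = (-1) ^ n" by (rule minus_one_power_cong)
        then have "parities ws \<in> ?X \<longleftrightarrow> (-1 :: int) ^ n = (-1) ^ a" using bits by (simp add: X_set_def)
        also have "\<dots> \<longleftrightarrow> n mod 2 = a" using a by (auto simp: minus_one_power_iff odd_iff_mod_2_eq_one)
        finally show ?thesis .
      qed
      moreover have "sign_bits ws \<in> ?Y (parities ws) \<longleftrightarrow> combined_sign \<rho> ws = (-1) ^ b"
      proof -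
        let ?z = "z_sign \<rho> (parities ws)"
        \<comment> \<open>A sign is its own inverse, so it can be moved to the other side, where
          \<open>Y_set\<close> has it.\<close>
        have "?z = 1 \<or> ?z = -1" using word_sign_cases[of \<rho>] by (auto simp: z_sign_def minus_one_power_iff)
        then have "(-1) ^ sum_list (sign_bits ws) = (-1) ^ b * ?z \<longleftrightarrow> ?z * (-1) ^ sum_list (sign_bits ws) = (-1) ^ b"
          by auto
        then show ?thesis using True bits by (simp add: Y_set_def combined_sign_eq)
      qed
      ultimately show ?thesis using True \<open>ws \<in> B\<close> by (simp add: h_def shape_tuples_def)
    next
      case False
      then show ?thesis using n by (auto simp: B_def tuples_def shape_tuples_def in_set_conv_nth)
    qed
    then show ?thesis by (intro set_eqI) (simp only: mem_Collect_eq)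
  qed
  finally show ?thesis .
qed

lemma shape_tuples_empty: "n < length \<rho> \<Longrightarrow> shape_tuples r a b \<rho> n = {}"
  by (auto simp: shape_tuples_def)

text \<open>The hypothesis on \<open>r\<close> excludes the empty permutation, which has no
  occurrences and whose empty kernel is not the shape of any permutation of positive size. All other
  permutations with \<open>r\<close> occurrences have their shape among those of size
  \<open>2 * r + 1\<close>.\<close>

lemma bij_betw_decomposition:
  assumes r: "r \<ge> 1"
  shows "bij_betw (\<lambda>w. (kernel_shape w, cell_words w)) {w \<in> class_words r a b. length w = n}
    (SIGMA \<rho>:kernel_shapes (2 * r + 1). shape_tuples r a b \<rho> n)"
proof -
  have mem: "w \<in> class_words r a b \<and> length w = n \<longleftrightarrow> cell_words w \<in> shape_tuples r a b (kernel_shape w) n"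
    if "w \<in> perm_words" for w
    using that cell_words_perm[OF that] length_decomposition[OF that] num132_decomposition[OF that]
      word_sign_decomposition[OF that]
    by (auto simp: class_words_def shape_tuples_def sum_list_map_nth)
  have shape: "kernel_shape w \<in> kernel_shapes (2 * r + 1)" if "w \<in> class_words r a b" for w
  proof -
    have "occs132 [] = {}" by (auto simp: occs132_def)
    then have "w \<noteq> []" using that r by (auto simp: class_words_def num132_def)
    then show ?thesis using kernel_shape_in_kernel_shapes[of w] that by (auto simp: class_words_def)
  qed
  have perm: "w \<in> perm_words" if "w \<in> class_words r a b" for w using that by (simp add: class_words_def)
  show ?thesis
  proof (rule bij_betw_imageI)
    show "inj_on (\<lambda>w. (kernel_shape w, cell_words w)) {w \<in> class_words r a b. length w = n}"
      using decomposition_inject perm by (intro inj_onI) auto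
    show "(\<lambda>w. (kernel_shape w, cell_words w)) ` {w \<in> class_words r a b. length w = n} =
      (SIGMA \<rho>:kernel_shapes (2 * r + 1). shape_tuples r a b \<rho> n)"
    proof (intro equalityI subsetI)
      fix t assume "t \<in> (SIGMA \<rho>:kernel_shapes (2 * r + 1). shape_tuples r a b \<rho> n)"
      then obtain \<rho> ws where t: "t = (\<rho>, ws)" "\<rho> \<in> kernel_shapes (2 * r + 1)" "ws \<in> shape_tuples r a b \<rho> n"
        by auto
      then have "length ws = num_feasible \<rho>" "set ws \<subseteq> perm_words" by (auto simp: shape_tuples_def)
      then obtain w where w: "w \<in> perm_words" "kernel_shape w = \<rho>" "cell_words w = ws"
        using inflation_exists kernel_shapes_conn[OF t(2)] by blast
      then have "w \<in> {w \<in> class_words r a b. length w = n}" using mem t(3) by simp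
      then show "t \<in> (\<lambda>w. (kernel_shape w, cell_words w)) ` {w \<in> class_words r a b. length w = n}"
        using w t(1) by blast
    qed (use mem shape perm in auto)
  qed
qed

theorem theorem3:
  fixes r a b :: nat
  assumes "r \<ge> 1" and "a \<in> {0, 1}" and "b \<in> {0, 1}"
  shows "H_gf r a b =
    (\<Sum>\<rho> \<in> kernel_shapes (2 * r + 1).
       fps_X ^ length \<rho> * (\<Sum>rs \<in> distributions r \<rho>. L_gf \<rho> rs a b))"
proof (rule fps_ext)
  fix n
  let ?S = "kernel_shapes (2 * r + 1)"
  have fin: "finite ?S" by (simp add: kernel_shapes_def)
  \<comment> \<open>The power of \<open>fps_X\<close> shifts the degree by the size of the shape.
    Below that degree the coefficient is 0 and no tuple fits, so the truncated difference does no
    harm.\<close>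
  have coeff: "fps_nth (fps_X ^ length \<rho> * (\<Sum>rs \<in> distributions r \<rho>. L_gf \<rho> rs a b)) n =
      of_nat (card (shape_tuples r a b \<rho> n))" for \<rho>
    using L_gf_sum_nth[OF assms(2), where r = r and b = b] shape_tuples_empty[of n \<rho> r a b]
    by (cases "length \<rho> \<le> n") (simp_all add: fps_X_power_mult_nth)
  have "card (SIGMA \<rho>:?S. shape_tuples r a b \<rho> n) = (\<Sum>\<rho> \<in> ?S. card (shape_tuples r a b \<rho> n))"
    using fin finite_shape_tuples by (simp add: card_SigmaI)
  then have "card {w \<in> class_words r a b. length w = n} = (\<Sum>\<rho> \<in> ?S. card (shape_tuples r a b \<rho> n))"
    using bij_betw_same_card[OF bij_betw_decomposition[OF assms(1)]] by metis
  then show "fps_nth (H_gf r a b) n = fps_nth (\<Sum>\<rho> \<in> ?S.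
       fps_X ^ length \<rho> * (\<Sum>rs \<in> distributions r \<rho>. L_gf \<rho> rs a b)) n"
    using H_gf_nth[OF assms(2,3)] by (simp add: fps_sum_nth coeff)
qed

end
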